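(* Suppose $X$ satisfies condition (A) on $T$ (see context) and $d<Q:=\sum_{j=1}^N(1/H_j)$. Then there exists a finite constant $C$ such that for all intervals $S$ in $T$, for all $x\in\mathbb{R}^d$ and all integers $n\ge 1$, \[ \mathbb{E}[L(x,S)^n]\le C^n(n!)^{d/Q}\lambda_N(S)^{n(1-d/Q)}. \] In particular, for all $a\in T$ and $r\in(0,1)$ with $B_\rho(a,r)\subset T$ and all $x\in\mathbb{R}^d$, $n\ge1$, \[ \mathbb{E}[L(x,B_\rho(a,r))^n]\le C^n(n!)^{d/Q}r^{n(Q-d)}. \]
   Context: **Field.** $N,d\ge1$ are integers, $\lambda_N$ is Lebesgue measure on $\mathbb{R}^N$. $X=\{X(t),t\in\mathbb{R}^N\}$, $X(t)=(X_1(t),\dots,X_d(t))$, is a mean zero continuous Gaussian random field with values in $\mathbb{R}^d$, where $X_1,\dots,X_d$ are i.i.d. copies of a real-valued Gaussian field $Y=\{Y(t),t\in\mathbb{R}^N\}$. $T$ is a closed (or open) bounded interval in $\mathbb{R}^N$ (interval means rectangle, i.e. product of one-dimensional intervals), with lower corner $(\tau_1,\dots,\tau_N)$ and side lengths $h_j>0$. **Condition (A) on $T$.** There is a constant vector $H=(H_1,\dots,H_N)\in(0,1)^N$ such that, with $\rho(t,s)=\sum_{j=1}^N|t_j-s_j|^{H_j}$: (A1) there are constants $0<C_1\le C_2<\infty$ with $C_1\rho^2(t,s)\le\mathbb{E}[(Y(t)-Y(s))^2]\le C_2\rho^2(t,s)$ for all $t,s\in T$; (A2) there is a constant $C_3>0$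 such that for all integers $n\ge1$ and all $t,t^1,\dots,t^n\in T$, $\mathrm{Var}(Y(t)\,|\,Y(t^1),\dots,Y(t^n))\ge C_3\min_{0\le k\le n}\rho^2(t,t^k)$, where $t^0=0$. $B_\rho(a,r)=\{t\in\mathbb{R}^N:\rho(t,a)\le r\}$. **Local time.** $X$ has a local time on a Borel set $S$ if the occupation measure $\mu_S(B)=\lambda_N\{t\in S:X(t)\in B\}$, $B\in\mathscr{B}(\mathbb{R}^d)$, is absolutely continuous with respect to $\lambda_d$; then $L(x,S)=\frac{d\mu_S}{d\lambda_d}(x)$. It is jointly continuous on $T$ if there is a version such that a.s. $(x,s)\mapsto L(x,T\cap\prod_{j=1}^N[\tau_j,\tau_j+s_j])$ is continuous on $\mathbb{R}^d\times\prod_{j=1}^N[0,h_j]$; such a version extends uniquely to a kernel, each $L(x,\cdot)$ being a finite Borel measure on $T$. It is known that under condition (A) on $T$ and $d<Q$, $X$ has a jointly continuous local time on $T$; $L$ always denotes this version. *)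

theory Defs
  imports "HOL-Probability.Probability"
begin

section \<open>Gaussian random fields\<close>

text \<open>A random field is a function of the parameter and of the sample point, in this order.
  Constant random variables are admitted as (degenerate) Gaussian variables.\<close>

definition gaussian_rv :: "'w measure \<Rightarrow> ('w \<Rightarrow> real) \<Rightarrow> bool" where
  "gaussian_rv M Z \<longleftrightarrow> Z \<in> borel_measurable M \<and>
     ((\<exists>\<mu>. AE \<omega> in M. Z \<omega> = \<mu>) \<or>
      (\<exists>\<mu> \<sigma>. 0 < \<sigma> \<and> distributed M lborel Z (\<lambda>x. ennreal (normal_density \<mu> \<sigma> x))))"

text \<open>Joint Gaussianity of the finite-dimensional marginals, stated through linear functionals.
  The value space is \<^typ>\<open>real\<close> or \<^typ>\<open>real ^ 'd\<close>; for the former the inner product is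
  multiplication.\<close>

definition gaussian_field :: "'w measure \<Rightarrow> ('t \<Rightarrow> 'w \<Rightarrow> 'v::euclidean_space) \<Rightarrow> bool" where
  "gaussian_field M X \<longleftrightarrow> (\<forall>t. X t \<in> borel_measurable M) \<and>
     (\<forall>F c. finite F \<longrightarrow> gaussian_rv M (\<lambda>\<omega>. \<Sum>t\<in>F. c t \<bullet> X t \<omega>))"

definition mean_zero :: "'w measure \<Rightarrow> ('t \<Rightarrow> 'w \<Rightarrow> 'v::euclidean_space) \<Rightarrow> bool" where
  "mean_zero M X \<longleftrightarrow> (\<forall>t. integrable M (X t) \<and> integral\<^sup>L M (X t) = 0)"

definition continuous_field ::
  "'w measure \<Rightarrow> ('t::topological_space \<Rightarrow> 'w \<Rightarrow> 'v::topological_space) \<Rightarrow> bool" where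
  "continuous_field M X \<longleftrightarrow> (AE \<omega> in M. continuous_on UNIV (\<lambda>t. X t \<omega>))"

text \<open>The coordinate fields of \<open>X\<close> are independent as processes, and each has the same law (on the
  product sigma-algebra) as \<open>Y\<close>, which may live on another probability space \<open>P\<close>.\<close>

definition iid_copies ::
  "'w measure \<Rightarrow> ('t \<Rightarrow> 'w \<Rightarrow> real ^ 'd) \<Rightarrow> 'u measure \<Rightarrow> ('t \<Rightarrow> 'u \<Rightarrow> real) \<Rightarrow> bool" where
  "iid_copies M X P Y \<longleftrightarrow>
     prob_space.indep_vars M (\<lambda>_. \<Pi>\<^sub>M t\<in>UNIV. borel) (\<lambda>j \<omega> t. X t \<omega> $ j) UNIV \<and>
     (\<forall>j. distr M (\<Pi>\<^sub>M t\<in>UNIV. borel) (\<lambda>\<omega> t. X t \<omega> $ j) =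
          distr P (\<Pi>\<^sub>M t\<in>UNIV. borel) (\<lambda>\<omega> t. Y t \<omega>))"

section \<open>Condition (A)\<close>

definition rho :: "real ^ 'n \<Rightarrow> real ^ 'n \<Rightarrow> real ^ 'n \<Rightarrow> real" where
  "rho H t s = (\<Sum>j\<in>UNIV. \<bar>t $ j - s $ j\<bar> powr (H $ j))"

definition rho_ball :: "real ^ 'n \<Rightarrow> real ^ 'n \<Rightarrow> real \<Rightarrow> (real ^ 'n) set" where
  "rho_ball H a r = {t. rho H t a \<le> r}"

definition hdim :: "real ^ 'n \<Rightarrow> real" where
  "hdim H = (\<Sum>j\<in>UNIV. 1 / H $ j)"

definition cond_variance :: "'u measure \<Rightarrow> 'u measure \<Rightarrow> ('u \<Rightarrow> real) \<Rightarrow> 'u \<Rightarrow> real" where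
  "cond_variance P F Z = real_cond_exp P F (\<lambda>\<omega>. (Z \<omega> - real_cond_exp P F Z \<omega>)\<^sup>2)"

text \<open>The sigma-algebra on \<open>space P\<close> generated by \<open>Y (u 1), \<dots>, Y (u n)\<close>.\<close>

definition generated_by ::
  "'u measure \<Rightarrow> ('t \<Rightarrow> 'u \<Rightarrow> real) \<Rightarrow> nat \<Rightarrow> (nat \<Rightarrow> 't) \<Rightarrow> 'u measure" where
  "generated_by P Y n u =
     vimage_algebra (space P) (\<lambda>\<omega>. \<lambda>k\<in>{1..n}. Y (u k) \<omega>) (\<Pi>\<^sub>M k\<in>{1..n}. borel)"

definition condition_A ::
  "'u measure \<Rightarrow> (real ^ 'n \<Rightarrow> 'u \<Rightarrow> real) \<Rightarrow> (real ^ 'n) set \<Rightarrow> real ^ 'n \<Rightarrow> bool" where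
  "condition_A P Y T H \<longleftrightarrow>
     (\<forall>j. 0 < H $ j \<and> H $ j < 1) \<and>
     (\<exists>C1 C2. 0 < C1 \<and> C1 \<le> C2 \<and>
        (\<forall>t\<in>T. \<forall>s\<in>T.
           C1 * (rho H t s)\<^sup>2 \<le> (\<integral>\<omega>. (Y t \<omega> - Y s \<omega>)\<^sup>2 \<partial>P) \<and>
           (\<integral>\<omega>. (Y t \<omega> - Y s \<omega>)\<^sup>2 \<partial>P) \<le> C2 * (rho H t s)\<^sup>2)) \<and>
     (\<exists>C3>0. \<forall>n\<ge>1. \<forall>t\<in>T. \<forall>u. u 0 = 0 \<and> (\<forall>k\<in>{1..n}. u k \<in> T) \<longrightarrow>
        (AE \<omega> in P. cond_variance P (generated_by P Y n u) (Y t) \<omega>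
                      \<ge> C3 * (MIN k\<in>{0..n}. (rho H t (u k))\<^sup>2)))"

section \<open>Local times\<close>

definition occupation_measure ::
  "(real ^ 'n \<Rightarrow> real ^ 'd) \<Rightarrow> (real ^ 'n) set \<Rightarrow> (real ^ 'd) measure" where
  "occupation_measure f S = distr (restrict_space lborel S) borel f"

definition local_time_version ::
  "(real ^ 'n \<Rightarrow> real ^ 'd) \<Rightarrow> (real ^ 'n) set \<Rightarrow> (real ^ 'd \<Rightarrow> ennreal) \<Rightarrow> bool" where
  "local_time_version f S l \<longleftrightarrow>
     absolutely_continuous lborel (occupation_measure f S) \<and>
     (AE x in lborel. l x = RN_deriv lborel (occupation_measure f S) x)"

text \<open>\<open>L \<omega> x\<close> is the measure \<open>L(x, \<cdot>)\<close> for the sample point \<open>\<omega>\<close>, regarded as a Borel measure on the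
  whole parameter space that does not charge the complement of \<open>T\<close>; \<open>\<tau>\<close> and \<open>h\<close> are the lower corner
  and the side lengths of \<open>T\<close>.\<close>

definition jointly_continuous_local_time ::
  "'w measure \<Rightarrow> (real ^ 'n \<Rightarrow> 'w \<Rightarrow> real ^ 'd) \<Rightarrow> (real ^ 'n) set \<Rightarrow> real ^ 'n \<Rightarrow> real ^ 'n \<Rightarrow>
   ('w \<Rightarrow> real ^ 'd \<Rightarrow> (real ^ 'n) measure) \<Rightarrow> bool" where
  "jointly_continuous_local_time M X T \<tau> h L \<longleftrightarrow>
     (\<forall>S\<in>sets borel. S \<subseteq> T \<longrightarrow>
        (AE \<omega> in M. local_time_version (\<lambda>t. X t \<omega>) S (\<lambda>x. emeasure (L \<omega> x) S))) \<and>
     (AE \<omega> in M. \<forall>x. sets (L \<omega> x) = sets borel \<and> finite_measure (L \<omega> x) \<and>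
                       emeasure (L \<omega> x) (- T) = 0) \<and>
     (AE \<omega> in M. continuous_on (UNIV \<times> cbox 0 h)
                       (\<lambda>(x, s). measure (L \<omega> x) (T \<inter> cbox \<tau> (\<tau> + s))))"

end

theory Submission
  imports Defs
begin

text \<open>The \<open>n\<close>-th moment of \<open>L(x,S)\<close> is bounded by the integral over \<open>S\<^sup>n\<close> of the density of
  \<open>(X(t\<^sub>1), \<dots>, X(t\<^sub>n))\<close> at \<open>(x, \<dots>, x)\<close>, that is, of a product of \<open>d\<close>-th powers of inverse conditional
  standard deviations. Densities and determinants are avoided by working with cubes of side \<open>2 e\<close>:
  the indicator of \<open>[-1, 1]\<close> is at most \<open>2 exp (- y\<^sup>2 / 2)\<close>, which is a Fourier transform of a Gaussian,
  so the probability that \<open>Y\<close> is within \<open>e\<close> of \<open>x\<close> at \<open>n\<close> points is controlled by an \<open>n\<close>-fold Gaussian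
  integral. Gram--Schmidt evaluates this integral and produces the residual variances of \<open>Y(t\<^sub>k)\<close>
  given the earlier points. A linear residual variance is at least the conditional variance, because
  conditional expectation is the best predictor, so (A2) applies. Integrating
  \<open>min\<^sub>k \<rho>(t, t\<^sub>k) powr (- d)\<close> over \<open>t \<in> S\<close> one point at a time costs a factor
  \<open>C * m powr (d / Q) * |S| powr (1 - d / Q)\<close> when \<open>m\<close> points are present, and these
  factors multiply to the claim. Finally \<open>L(x,S)\<close> is recovered from occupation measures of shrinking cubes around \<open>x\<close> by joint continuity
  and Fatou's lemma. A \<open>\<rho>\<close>-ball lies in a box of comparable volume.\<close>

section \<open>Integrals of inverse powers of the anisotropic distance\<close>

lemma rho_nonneg [simp]: "0 \<le> rho H t s"
  unfolding rho_def by (intro sum_nonneg) auto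

lemma rho_eq_0_iff: "rho H t s = 0 \<longleftrightarrow> t = s"
  unfolding rho_def by (subst sum_nonneg_eq_0_iff) (auto simp: vec_eq_iff)

lemma borel_measurable_rho [measurable (raw)]:
  assumes "f \<in> borel_measurable M"
  shows "(\<lambda>x. rho H (f x) s) \<in> borel_measurable M"
  unfolding rho_def using assms by measurable

lemma emeasure_lborel_cbox_cart:
  fixes a b :: "real ^ 'n"
  assumes "\<And>j. a $ j \<le> b $ j"
  shows "emeasure lborel (cbox a b) = ennreal (\<Prod>j\<in>UNIV. b $ j - a $ j)"
proof -
  have "emeasure lborel (cbox a b) = ennreal (measure lborel (cbox a b))"
    using emeasure_lborel_cbox_finite[of a b] by (intro emeasure_eq_ennreal_measure) (simp add: less_top)
  also have "measure lborel (cbox a b) = (\<Prod>j\<in>UNIV. b $ j - a $ j)"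
    by (rule content_cbox_cart) (metis assms interval_ne_empty_cart(1))
  finally show ?thesis .
qed

text \<open>Each summand of \<open>rho\<close> is at most \<open>r\<close>, which bounds the
  \<open>j\<close>-th coordinate by \<open>r powr (1 / H $ j)\<close>. The box has volume a constant
  times \<open>r powr hdim H\<close>, so \<open>hdim H\<close> acts as the dimension of the space
  for \<open>rho\<close>.\<close>

lemma rho_ball_subset_cbox:
  assumes H: "\<And>j. 0 < H $ j" and r: "0 < r"
  shows "rho_ball H a r \<subseteq> cbox (\<chi> j. a $ j - r powr (1 / H $ j)) (\<chi> j. a $ j + r powr (1 / H $ j))"
proof
  fix t assume t: "t \<in> rho_ball H a r"
  have "\<bar>t $ j - a $ j\<bar> \<le> r powr (1 / H $ j)" for j
  proof -
    have "\<bar>t $ j - a $ j\<bar> powr (H $ j) \<le> rho H t a"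
      unfolding rho_def by (rule member_le_sum) auto
    also have "\<dots> \<le> r" using t by (simp add: rho_ball_def)
    finally have "(\<bar>t $ j - a $ j\<bar> powr (H $ j)) powr (1 / H $ j) \<le> r powr (1 / H $ j)"
      using H[of j] by (intro powr_mono2) auto
    then show ?thesis using H[of j] by (simp add: powr_powr)
  qed
  then show "t \<in> cbox (\<chi> j. a $ j - r powr (1 / H $ j)) (\<chi> j. a $ j + r powr (1 / H $ j))"
    by (simp add: mem_box_cart abs_le_iff) (metis add.commute diff_le_eq minus_diff_eq minus_le_iff)
qed

lemma prod_powr_hdim:
  fixes H :: "real ^ 'n"
  assumes "0 < r"
  shows "(\<Prod>j\<in>(UNIV::'n set). 2 * r powr (1 / H $ j)) = 2 ^ CARD('n) * r powr hdim H"
  unfolding hdim_def by (subst powr_sum) (use assms in \<open>simp_all add: prod.distrib\<close>)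

lemma emeasure_rho_cbox:
  fixes H :: "real ^ 'n"
  assumes "0 < r"
  shows "emeasure lborel (cbox (\<chi> j. a $ j - r powr (1 / H $ j)) (\<chi> j. a $ j + r powr (1 / H $ j)))
    = ennreal (2 ^ CARD('n) * r powr hdim H)"
proof -
  have "a $ j + r powr (1 / H $ j) - (a $ j - r powr (1 / H $ j)) = 2 * r powr (1 / H $ j)" for j
    by simp
  then show ?thesis
    by (subst emeasure_lborel_cbox_cart) (simp_all only: vec_lambda_beta prod_powr_hdim[OF assms], simp)
qed

lemma rho_ball_borel [measurable]: "rho_ball H a r \<in> sets borel"
  unfolding rho_ball_def by measurable

lemma emeasure_rho_ball_le:
  fixes H :: "real ^ 'n"
  assumes H: "\<And>j. 0 < H $ j" and r: "0 < r"
  shows "emeasure lborel (rho_ball H a r) \<le> ennreal (2 ^ CARD('n) * r powr hdim H)"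
  using emeasure_mono[OF rho_ball_subset_cbox[OF assms, of a], of lborel] emeasure_rho_cbox[OF r, of a H]
  by simp

text \<open>The least \<open>k\<close> with \<open>r / 2 ^ k < x\<close> is positive because
  \<open>x \<le> r\<close>; its predecessor is the index of the dyadic shell containing
  \<open>x\<close>.\<close>

lemma dyadic_shell:
  fixes r x :: real
  assumes "0 < x" "x \<le> r"
  obtains m :: nat where "x \<le> r / 2 ^ m" "r / 2 ^ Suc m < x"
proof -
  have ex: "\<exists>m. r / 2 ^ m < x"
    using real_arch_pow_inv[of "x / r" "1/2"] assms
    by (auto simp: field_simps power_divide)
  define k where "k = (LEAST m. r / 2 ^ m < x)"
  have k: "r / 2 ^ k < x" unfolding k_def using ex by (rule LeastI_ex)
  have "k \<noteq> 0" using k assms by (cases k) auto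
  then obtain m where m: "k = Suc m" by (cases k) auto
  have "\<not> r / 2 ^ m < x" using not_less_Least[of m "\<lambda>m. r / 2 ^ m < x"] m k_def by auto
  with k m show thesis by (intro that[of m]) auto
qed

text \<open>Dyadic shells: where \<open>rho H t p\<close> lies between \<open>r / 2 ^ Suc m\<close>
  and \<open>r / 2 ^ m\<close> the integrand is at most \<open>(2 ^ Suc m / r) ^ d\<close>, and the
  enclosing ball has volume at most of order \<open>(r / 2 ^ m) powr hdim H\<close>. The
  contributions form a geometric series of ratio \<open>2 powr (d - hdim H)\<close>, which converges
  since \<open>d < hdim H\<close>.\<close>

lemma nn_integral_rho_ball:
  fixes H p :: "real ^ 'n"
  assumes H: "\<And>j. 0 < H $ j" and d: "real d < hdim H" and r: "0 < r"
  shows "(\<integral>\<^sup>+t. inverse (ennreal (rho H t p)) ^ d * indicator (rho_ball H p r) t \<partial>lborel)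
     \<le> ennreal (2 ^ d * 2 ^ CARD('n) / (1 - 2 powr (real d - hdim H)) * r powr (hdim H - d))"
proof -
  define Q where "Q = hdim H"
  define q where "q = 2 powr (real d - Q)"
  have q: "0 < q" "q < 1" unfolding q_def using d powr_less_mono[of "real d - Q" 0 2] by (auto simp: Q_def)
  have "(\<integral>\<^sup>+t. inverse (ennreal (rho H t p)) ^ d * indicator (rho_ball H p r) t \<partial>lborel)
     \<le> (\<integral>\<^sup>+t. (\<Sum>m. ennreal ((2 ^ Suc m / r) ^ d) * indicator (rho_ball H p (r / 2 ^ m)) t) \<partial>lborel)"
  \<comment> \<open>A shell index exists only at positive distance, so the centre, a null set, is
    left out.\<close>
  proof (rule nn_integral_mono_AE, rule AE_mp[OF AE_lborel_singleton[of p]], rule AE_I2, rule impI)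
    fix t assume "t \<noteq> p"
    then have t: "0 < rho H t p" using rho_eq_0_iff[of H t p] rho_nonneg[of H t p] by linarith
    show "inverse (ennreal (rho H t p)) ^ d * indicator (rho_ball H p r) t
      \<le> (\<Sum>m. ennreal ((2 ^ Suc m / r) ^ d) * indicator (rho_ball H p (r / 2 ^ m)) t)"
    proof (cases "t \<in> rho_ball H p r")
      case True
      then have "rho H t p \<le> r" by (simp add: rho_ball_def)
      from dyadic_shell[OF t this] obtain m where m: "rho H t p \<le> r / 2 ^ m" "r / 2 ^ Suc m < rho H t p" .
      have "inverse (ennreal (rho H t p)) ^ d = ennreal (inverse (rho H t p) ^ d)"
        using t by (simp add: inverse_ennreal ennreal_power)
      also have "\<dots> \<le> ennreal ((2 ^ Suc m / r) ^ d)"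
      proof (rule ennreal_leI, rule power_mono)
        show "inverse (rho H t p) \<le> 2 ^ Suc m / r"
          using m(2) t r by (simp add: field_simps)
      qed (use t in auto)
      also have "\<dots> = ennreal ((2 ^ Suc m / r) ^ d) * indicator (rho_ball H p (r / 2 ^ m)) t"
        using m by (simp add: rho_ball_def)
      also have "\<dots> \<le> (\<Sum>m. ennreal ((2 ^ Suc m / r) ^ d) * indicator (rho_ball H p (r / 2 ^ m)) t)"
        using sum_le_suminf[OF summableI finite.insertI[OF finite.emptyI, of m],
            of "\<lambda>m. ennreal ((2 ^ Suc m / r) ^ d) * indicator (rho_ball H p (r / 2 ^ m)) t"]
        by (simp only: sum.insert finite.emptyI empty_iff not_False_eq_True sum.empty add_0_right zero_le)
      finally show ?thesis using True by simp
    qed auto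
  qed
  also have "\<dots> = (\<Sum>m. ennreal ((2 ^ Suc m / r) ^ d) * emeasure lborel (rho_ball H p (r / 2 ^ m)))"
    by (subst nn_integral_suminf) (auto simp: nn_integral_cmult_indicator)
  also have "\<dots> \<le> (\<Sum>m. ennreal (2 ^ d * 2 ^ CARD('n) * r powr (Q - d) * q ^ m))"
  proof (rule suminf_le)
    fix m
    have "ennreal ((2 ^ Suc m / r) ^ d) * emeasure lborel (rho_ball H p (r / 2 ^ m))
      \<le> ennreal ((2 ^ Suc m / r) ^ d) * ennreal (2 ^ CARD('n) * (r / 2 ^ m) powr Q)"
      using emeasure_rho_ball_le[OF H, of "r / 2 ^ m" p] r by (intro mult_left_mono) (auto simp: Q_def)
    also have "\<dots> = ennreal ((2 ^ Suc m / r) ^ d * (2 ^ CARD('n) * (r / 2 ^ m) powr Q))"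
      using r by (subst ennreal_mult) auto
    also have "(2 ^ Suc m / r) ^ d * (2 ^ CARD('n) * (r / 2 ^ m) powr Q)
      = 2 ^ d * 2 ^ CARD('n) * r powr (Q - d) * q ^ m"
    proof -
      have 1: "(2 ^ Suc m / r) ^ d = 2 ^ d * (2 powr (real m * real d)) / r powr d"
        using r by (simp add: powr_realpow power_divide power_mult_distrib flip: power_mult of_nat_mult)
      have 2: "(r / 2 ^ m) powr Q = r powr Q / 2 powr (real m * Q)"
        using r by (simp add: powr_divide powr_powr flip: powr_realpow)
      have 3: "q ^ m = 2 powr (real m * real d) / 2 powr (real m * Q)"
        unfolding q_def by (simp add: powr_power powr_diff[symmetric] algebra_simps)
      show ?thesis unfolding 1 2 3 using r by (simp add: powr_diff)
    qed
    finally show "ennreal ((2 ^ Suc m / r) ^ d) * emeasure lborel (rho_ball H p (r / 2 ^ m))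
       \<le> ennreal (2 ^ d * 2 ^ CARD('n) * r powr (Q - d) * q ^ m)" .
  qed auto
  also have "\<dots> = ennreal (2 ^ d * 2 ^ CARD('n) * r powr (Q - d) * (1 / (1 - q)))"
    by (rule suminf_ennreal_eq[OF _ sums_mult[OF geometric_sums]]) (use q r in auto)
  finally show ?thesis by (simp add: q_def Q_def algebra_simps)
qed

text \<open>The minimum of \<open>\<rho>\<close> over \<open>m\<close> points behaves, on a set \<open>S\<close>, at worst as if \<open>S\<close> were split
  evenly among \<open>m\<close> \<open>\<rho>\<close>-balls: the radius \<open>r\<close> in the proof is that of a ball of volume \<open>|S| / m\<close>.\<close>

lemma nn_integral_min_rho:
  fixes H :: "real ^ 'n" and A :: "(real ^ 'n) set"
  assumes H: "\<And>j. 0 < H $ j" and d: "real d < hdim H" and A: "finite A" "A \<noteq> {}" "card A \<le> m"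
    and S: "S \<in> sets borel" and l: "emeasure lborel S = ennreal l" "0 \<le> l"
  shows "(\<integral>\<^sup>+t. inverse (ennreal (Min (rho H t ` A))) ^ d * indicator S t \<partial>lborel)
     \<le> ennreal ((1 + 2 ^ d * 2 ^ CARD('n) / (1 - 2 powr (real d - hdim H))) *
          (m powr (real d / hdim H) * l powr (1 - real d / hdim H)))"
proof (cases "l = 0")
  \<comment> \<open>A null set is treated apart because the radius \<open>r\<close> below would be
    zero.\<close>
  case True
  then have "AE t in lborel. t \<notin> S"
    using l S by (intro AE_not_in) (auto simp: null_sets_def)
  then have "(\<integral>\<^sup>+t. inverse (ennreal (Min (rho H t ` A))) ^ d * indicator S t \<partial>lborel) = (\<integral>\<^sup>+t. 0 \<partial>(lborel::(real^'n) measure))"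
    by (intro nn_integral_cong_AE) auto
  then show ?thesis by simp
next
  case False
  with l have l0: "0 < l" by simp
  define Q where "Q = hdim H"
  have Q: "0 < Q" using d unfolding Q_def by simp
  define c where "c = 2 ^ d * 2 ^ CARD('n) / (1 - 2 powr (real d - Q))"
  have c: "0 \<le> c" unfolding c_def using d powr_less_mono[of "real d - Q" 0 2] by (auto simp: Q_def)
  have m: "0 < m" using A by (metis card_gt_0_iff less_le_trans)
  define r where "r = (l / m) powr (1 / Q)"
  have r: "0 < r" unfolding r_def using l0 m by simp
  \<comment> \<open>If the nearest point of \<open>A\<close> is farther than \<open>r\<close>, the
    integrand is at most \<open>inverse r ^ d\<close>; otherwise it is dominated by the singular
    term of that point, restricted to the ball around it.\<close>
  have "(\<integral>\<^sup>+t. inverse (ennreal (Min (rho H t ` A))) ^ d * indicator S t \<partial>lborel)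
    \<le> (\<integral>\<^sup>+t. ennreal (inverse r ^ d) * indicator S t +
          (\<Sum>p\<in>A. inverse (ennreal (rho H t p)) ^ d * indicator (rho_ball H p r) t) \<partial>lborel)"
  proof (rule nn_integral_mono)
    fix t
    have "Min (rho H t ` A) \<in> rho H t ` A" using A by (intro Min_in) auto
    then obtain p where p: "p \<in> A" "Min (rho H t ` A) = rho H t p" by auto
    show "inverse (ennreal (Min (rho H t ` A))) ^ d * indicator S t
      \<le> ennreal (inverse r ^ d) * indicator S t +
          (\<Sum>p\<in>A. inverse (ennreal (rho H t p)) ^ d * indicator (rho_ball H p r) t)"
    proof (cases "rho H t p \<le> r")
      case True
      then have "inverse (ennreal (Min (rho H t ` A))) ^ d * indicator S t
        \<le> inverse (ennreal (rho H t p)) ^ d * indicator (rho_ball H p r) t"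
        using p by (auto simp: rho_ball_def indicator_def)
      also have "\<dots> \<le> (\<Sum>p\<in>A. inverse (ennreal (rho H t p)) ^ d * indicator (rho_ball H p r) t)"
        using A(1) p(1)
        by (intro member_le_sum[where f = "\<lambda>p. inverse (ennreal (rho H t p)) ^ d * indicator (rho_ball H p r) t"]) auto
      finally show ?thesis by (simp add: add_increasing)
    next
      case False
      with r have "inverse (ennreal (rho H t p)) ^ d = ennreal (inverse (rho H t p) ^ d)"
        by (simp add: inverse_ennreal ennreal_power)
      also have "\<dots> \<le> ennreal (inverse r ^ d)"
        using False r by (intro ennreal_leI power_mono) (auto simp: field_simps)
      finally show ?thesis using p(2) by (auto simp: indicator_def add_increasing2)
    qed
  qed
  also have "\<dots> = ennreal (inverse r ^ d) * ennreal l +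
      (\<Sum>p\<in>A. (\<integral>\<^sup>+t. inverse (ennreal (rho H t p)) ^ d * indicator (rho_ball H p r) t \<partial>lborel))"
    using S l by (subst nn_integral_add) (auto simp: nn_integral_cmult_indicator nn_integral_sum)
  also have "\<dots> \<le> ennreal (inverse r ^ d) * ennreal l + (\<Sum>p\<in>A. ennreal (c * r powr (Q - d)))"
    unfolding c_def Q_def using nn_integral_rho_ball[OF H d r] by (intro add_left_mono sum_mono) auto
  also have "\<dots> = ennreal (inverse r ^ d * l + card A * (c * r powr (Q - d)))"
    using r l0 c by (simp add: ennreal_mult ennreal_plus ennreal_of_nat_eq_real_of_nat)
  also have "\<dots> \<le> ennreal (inverse r ^ d * l + m * (c * r powr (Q - d)))"
    using A(3) c by (intro ennreal_leI add_left_mono mult_right_mono) auto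
  \<comment> \<open>The radius balances the two terms: both \<open>inverse r ^ d * l\<close> and
    \<open>m * r powr (Q - d)\<close> equal
    \<open>m powr (d / Q) * l powr (1 - d / Q)\<close>.\<close>
  also have "inverse r ^ d * l + m * (c * r powr (Q - d)) = (1 + c) * (m powr (d / Q) * l powr (1 - d / Q))"
  proof -
    have "inverse r ^ d = (l / m) powr (- (d / Q))"
      using r l0 m unfolding r_def by (simp add: powr_power powr_minus[symmetric] power_inverse)
    also have "\<dots> = m powr (d / Q) * l powr (- (d / Q))"
      using l0 m by (simp add: powr_divide powr_minus field_simps)
    finally have 1: "inverse r ^ d = m powr (d / Q) * l powr (- (d / Q))" .
    have "r powr (Q - d) = (l / m) powr (1 - d / Q)"
      using Q unfolding r_def by (simp add: powr_powr field_simps)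
    also have "\<dots> = m powr (d / Q) * l powr (1 - d / Q) / m"
      using l0 m by (simp add: powr_divide powr_diff field_simps)
    finally have 2: "r powr (Q - d) = m powr (d / Q) * l powr (1 - d / Q) / m" .
    have 3: "l powr (1 - d / Q) = l * l powr (- (d / Q))"
      using l0 by (simp add: powr_diff powr_minus field_simps)
    show ?thesis unfolding 1 2 3 using m by (simp add: field_simps)
  qed
  finally show ?thesis unfolding c_def Q_def .
qed

section \<open>Small ball probabilities of Gaussian fields\<close>

text \<open>Pythagoras in L2: with \<open>E\<close> the conditional expectation,
  \<open>Z - W\<close> splits into \<open>Z - E\<close> and \<open>E - W\<close>, which are
  orthogonal since \<open>E - W\<close> is measurable with respect to \<open>F\<close>. The mean of
  the conditional variance is the squared norm of the first part.\<close>

lemma (in prob_space) cond_variance_le_integral_square: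
  fixes Z W :: "'a \<Rightarrow> real"
  assumes F: "subalgebra M F"
    and Z: "integrable M Z" "integrable M (\<lambda>x. (Z x)\<^sup>2)"
    and W: "W \<in> borel_measurable F" "integrable M (\<lambda>x. (W x)\<^sup>2)"
    and c: "AE x in M. c \<le> cond_variance M F Z x"
  shows "c \<le> (\<integral>x. (Z x - W x)\<^sup>2 \<partial>M)"
proof -
  interpret F: finite_measure_subalgebra M F
    using F by unfold_locales
  define E where "E = real_cond_exp M F Z"
  have prod: "integrable M (\<lambda>x. f x * g x)"
    if "integrable M (\<lambda>x. (f x)\<^sup>2)" "integrable M (\<lambda>x. (g x)\<^sup>2)" "f \<in> borel_measurable M" "g \<in> borel_measurable M"
    for f g :: "'a \<Rightarrow> real"
  proof (rule Bochner_Integration.integrable_bound[OF Bochner_Integration.integrable_add[OF that(1,2)]])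
    show "AE x in M. norm (f x * g x) \<le> norm ((f x)\<^sup>2 + (g x)\<^sup>2)"
    proof (rule AE_I2)
      fix x show "norm (f x * g x) \<le> norm ((f x)\<^sup>2 + (g x)\<^sup>2)"
        using sum_squares_bound[of "\<bar>f x\<bar>" "\<bar>g x\<bar>"] mult_nonneg_nonneg[OF abs_ge_zero[of "f x"] abs_ge_zero[of "g x"]]
        unfolding real_norm_def abs_mult power2_abs by linarith
    qed
  qed (use that in measurable)
  have [measurable]: "Z \<in> borel_measurable M" using Z by auto
  have [measurable]: "E \<in> borel_measurable M" "E \<in> borel_measurable F" by (auto simp: E_def)
  have [measurable]: "W \<in> borel_measurable F" "W \<in> borel_measurable M"
    using W measurable_from_subalg[OF F] by auto
  have E2: "integrable M (\<lambda>x. (E x)\<^sup>2)"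
    unfolding E_def
    by (rule F.integrable_convex_cond_exp[OF Z(1), where I = UNIV]) (use Z(2) convex_power2 in auto)
  note i = prod[OF Z(2) E2] prod[OF Z(2) W(2)] prod[OF E2 W(2)]
  have i': "integrable M (\<lambda>x. Z x * E x)" "integrable M (\<lambda>x. Z x * W x)" "integrable M (\<lambda>x. E x * W x)"
    by (auto intro: i)
  have D: "integrable M (\<lambda>x. (Z x - E x)\<^sup>2)"
    using Z(2) E2 i' by (simp add: power2_diff mult.assoc)
  have ZE: "integrable M (\<lambda>x. (E x - W x) * Z x)"
    using i' by (simp add: algebra_simps)
  have EE: "integrable M (\<lambda>x. (E x - W x) * E x)"
    using i' E2 by (simp add: algebra_simps power2_eq_square)
  have EW: "integrable M (\<lambda>x. (E x - W x)\<^sup>2)"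
    using W(2) E2 i' by (simp add: power2_diff mult.assoc)
  have orth: "(\<integral>x. (E x - W x) * E x \<partial>M) = (\<integral>x. (E x - W x) * Z x \<partial>M)"
    using F.real_cond_exp_intg(2)[OF ZE] by (simp add: E_def)
  have "(\<integral>x. c \<partial>M) \<le> (\<integral>x. cond_variance M F Z x \<partial>M)"
    by (rule integral_mono_AE[OF _ _ c]) (use F.real_cond_exp_int(1)[OF D] in \<open>auto simp: cond_variance_def E_def\<close>)
  then have "c \<le> (\<integral>x. cond_variance M F Z x \<partial>M)" by (simp add: prob_space)
  also have "\<dots> = (\<integral>x. (Z x - E x)\<^sup>2 \<partial>M)"
    unfolding cond_variance_def E_def[symmetric] by (rule F.real_cond_exp_int(2)[OF D])
  also have "\<dots> \<le> (\<integral>x. (Z x - E x)\<^sup>2 \<partial>M) + (\<integral>x. (E x - W x)\<^sup>2 \<partial>M)"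
    by simp
  \<comment> \<open>The added cross term has integral zero by \<open>orth\<close>.\<close>
  also have "\<dots> = (\<integral>x. (Z x - E x)\<^sup>2 + (E x - W x)\<^sup>2 + 2 * ((E x - W x) * Z x - (E x - W x) * E x) \<partial>M)"
    using D EW ZE EE orth by simp
  also have "\<dots> = (\<integral>x. (Z x - W x)\<^sup>2 \<partial>M)"
    by (rule Bochner_Integration.integral_cong) (auto simp: power2_eq_square algebra_simps)
  finally show ?thesis .
qed

section \<open>The linear span of a centered Gaussian field and its covariance form\<close>

locale centered_gaussian_field = prob_space P for P :: "'u measure" +
  fixes Y :: "'t \<Rightarrow> 'u \<Rightarrow> real"
  assumes gaussian: "gaussian_field P Y" and centered: "mean_zero P Y"
begin

definition lin :: "('u \<Rightarrow> real) set" where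
  "lin = {Z. \<exists>F c. finite F \<and> Z = (\<lambda>\<omega>. \<Sum>t\<in>F. c t * Y t \<omega>)}"

text \<open>On \<open>lin\<close> this is the covariance, because members of \<open>lin\<close> have
  mean zero. It is only positive semidefinite, so residual variances may vanish.\<close>

definition ip :: "('u \<Rightarrow> real) \<Rightarrow> ('u \<Rightarrow> real) \<Rightarrow> real" where
  "ip Z W = (\<integral>\<omega>. Z \<omega> * W \<omega> \<partial>P)"

lemma Y_measurable [measurable]: "Y t \<in> borel_measurable P"
  using gaussian by (auto simp: gaussian_field_def)

lemma lin_Y: "Y t \<in> lin"
  unfolding lin_def by (auto intro!: exI[of _ "{t}"] exI[of _ "\<lambda>_. 1"])

lemma lin_sum: "finite F \<Longrightarrow> (\<lambda>\<omega>. \<Sum>t\<in>F. c t * Y t \<omega>) \<in> lin"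
  unfolding lin_def by auto

lemma lin_0: "(\<lambda>\<omega>. 0) \<in> lin"
  using lin_sum[of "{}"] by simp

lemma lin_add:
  assumes "Z \<in> lin" "W \<in> lin"
  shows "(\<lambda>\<omega>. Z \<omega> + a * W \<omega>) \<in> lin"
proof -
  obtain F c where F: "finite F" "Z = (\<lambda>\<omega>. \<Sum>t\<in>F. c t * Y t \<omega>)" using assms(1) by (auto simp: lin_def)
  obtain G d where G: "finite G" "W = (\<lambda>\<omega>. \<Sum>t\<in>G. d t * Y t \<omega>)" using assms(2) by (auto simp: lin_def)
  have "(\<lambda>\<omega>. Z \<omega> + a * W \<omega>) = (\<lambda>\<omega>. \<Sum>t\<in>F \<union> G. ((if t \<in> F then c t else 0) + (if t \<in> G then a * d t else 0)) * Y t \<omega>)"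
  proof
    fix \<omega>
    have "(\<Sum>t\<in>F \<union> G. (if t \<in> F then c t else 0) * Y t \<omega>) = Z \<omega>"
      unfolding F(2) by (rule sum.mono_neutral_cong_right) (use F(1) G(1) in auto)
    moreover have "(\<Sum>t\<in>F \<union> G. (if t \<in> G then a * d t else 0) * Y t \<omega>) = a * W \<omega>"
      unfolding G(2) sum_distrib_left by (rule sum.mono_neutral_cong_right) (use F(1) G(1) in auto)
    ultimately show "Z \<omega> + a * W \<omega> = (\<Sum>t\<in>F \<union> G. ((if t \<in> F then c t else 0) + (if t \<in> G then a * d t else 0)) * Y t \<omega>)"
      by (simp only: distrib_right sum.distrib)
  qed
  then show ?thesis using lin_sum[of "F \<union> G"] F(1) G(1) by simp
qed

lemma lin_gaussian: "Z \<in> lin \<Longrightarrow> gaussian_rv P Z"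
  using gaussian by (auto simp: lin_def gaussian_field_def)

lemma lin_measurable: "Z \<in> lin \<Longrightarrow> Z \<in> borel_measurable P"
  using lin_gaussian by (auto simp: gaussian_rv_def)

lemma lin_integrable: "Z \<in> lin \<Longrightarrow> integrable P Z"
  and lin_mean: "Z \<in> lin \<Longrightarrow> integral\<^sup>L P Z = 0"
  using centered by (auto simp: lin_def mean_zero_def)

text \<open>Centering forces the mean parameter to be \<open>0\<close> in both cases of
  \<open>gaussian_rv\<close>; the constant case is then the degenerate Gaussian of variance
  zero.\<close>

lemma lin_gaussian_cases:
  assumes "Z \<in> lin"
  obtains "AE \<omega> in P. Z \<omega> = 0" | \<sigma> where "0 < \<sigma>" "distributed P lborel Z (\<lambda>x. ennreal (normal_density 0 \<sigma> x))"
proof -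
  consider \<mu> where "AE \<omega> in P. Z \<omega> = \<mu>"
    | \<mu> \<sigma> where "0 < \<sigma>" "distributed P lborel Z (\<lambda>x. ennreal (normal_density \<mu> \<sigma> x))"
    using lin_gaussian[OF assms] by (auto simp: gaussian_rv_def)
  then show thesis
  proof cases
    case 1
    have "integral\<^sup>L P Z = (\<integral>\<omega>. \<mu> \<partial>P)"
      by (rule integral_cong_AE) (use 1 lin_measurable[OF assms] in auto)
    then have "\<mu> = 0" using lin_mean[OF assms] by (simp add: prob_space)
    with 1 that(1) show thesis by simp
  next
    case 2
    have "\<mu> = 0" using normal_distributed_expectation[OF 2] lin_mean[OF assms] by simp
    with 2 that(2) show thesis by simp
  qed
qed

lemma lin_square_integrable:
  assumes Z: "Z \<in> lin"
  shows "integrable P (\<lambda>\<omega>. (Z \<omega>)\<^sup>2)"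
proof (rule lin_gaussian_cases[OF Z])
  assume 0: "AE \<omega> in P. Z \<omega> = 0"
  have "integrable P (\<lambda>\<omega>. (Z \<omega>)\<^sup>2) \<longleftrightarrow> integrable P (\<lambda>\<omega>. 0::real)"
    by (rule integrable_cong_AE) (use 0 lin_measurable[OF Z] in auto)
  then show ?thesis by simp
next
  fix \<sigma> :: real assume \<sigma>: "0 < \<sigma>" "distributed P lborel Z (\<lambda>x. ennreal (normal_density 0 \<sigma> x))"
  then show ?thesis
    using integrable_normal_moment[of \<sigma> 0 2] distributed_integrable[OF \<sigma>(2), of "\<lambda>x. x\<^sup>2"]
    by simp
qed

text \<open>Scaling by \<open>\<sigma>\<close> reduces this to the characteristic function of the
  standard normal law; in the degenerate case both sides are \<open>1\<close>.\<close>

lemma lin_char: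
  assumes Z: "Z \<in> lin"
  shows "(CLINT \<omega>|P. iexp (Z \<omega>)) = exp (- ip Z Z / 2)"
proof (rule lin_gaussian_cases[OF Z])
  assume 0: "AE \<omega> in P. Z \<omega> = 0"
  note [measurable] = lin_measurable[OF Z]
  have "(CLINT \<omega>|P. iexp (Z \<omega>)) = (CLINT \<omega>|P. 1)"
    by (rule integral_cong_AE) (use 0 in auto)
  moreover have "ip Z Z = (\<integral>\<omega>. 0 \<partial>P)"
    unfolding ip_def by (rule integral_cong_AE) (use 0 in auto)
  ultimately show ?thesis by (simp add: prob_space)
next
  fix \<sigma> :: real assume \<sigma>: "0 < \<sigma>" "distributed P lborel Z (\<lambda>x. ennreal (normal_density 0 \<sigma> x))"
  note [measurable] = lin_measurable[OF Z]
  have ip: "ip Z Z = \<sigma>\<^sup>2"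
    using normal_distributed_variance[OF \<sigma>] lin_mean[OF Z] by (simp add: ip_def power2_eq_square)
  have std: "distributed P lborel (\<lambda>\<omega>. Z \<omega> / \<sigma>) std_normal_density"
    using normal_standard_normal_convert[OF \<sigma>(1), of Z 0] \<sigma>(2) by simp
  have "char std_normal_distribution \<sigma> = char (distr P lborel (\<lambda>\<omega>. Z \<omega> / \<sigma>)) \<sigma>"
    using distributed_distr_eq_density[OF std] by simp
  also have "\<dots> = (CLINT \<omega>|P. iexp (\<sigma> * (Z \<omega> / \<sigma>)))"
    unfolding char_def by (subst integral_distr) auto
  also have "\<dots> = (CLINT \<omega>|P. iexp (Z \<omega>))" using \<sigma>(1) by simp
  finally show ?thesis using ip by (simp add: char_std_normal_distribution)
qed

text \<open>Polarization reduces the product to squares of members of \<open>lin\<close>.\<close>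

lemma lin_mult_integrable:
  assumes "Z \<in> lin" "W \<in> lin"
  shows "integrable P (\<lambda>\<omega>. Z \<omega> * W \<omega>)"
proof -
  have eq: "(\<lambda>\<omega>. Z \<omega> * W \<omega>) = (\<lambda>\<omega>. ((Z \<omega> + 1 * W \<omega>)\<^sup>2 - (Z \<omega>)\<^sup>2 - (W \<omega>)\<^sup>2) / 2)"
    by (auto simp: power2_eq_square algebra_simps)
  show ?thesis unfolding eq
    using assms by (intro integrable_divide Bochner_Integration.integrable_diff lin_square_integrable lin_add)
qed

lemma ip_commute: "ip Z W = ip W Z"
  by (simp add: ip_def mult.commute)

lemma ip_add_left:
  assumes "Z \<in> lin" "W \<in> lin" "V \<in> lin"
  shows "ip (\<lambda>\<omega>. Z \<omega> + a * W \<omega>) V = ip Z V + a * ip W V"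
  unfolding ip_def using lin_mult_integrable assms by (simp add: distrib_right mult.assoc)

lemma ip_add_right:
  assumes "Z \<in> lin" "W \<in> lin" "V \<in> lin"
  shows "ip V (\<lambda>\<omega>. Z \<omega> + a * W \<omega>) = ip V Z + a * ip V W"
  using ip_add_left[OF assms] by (simp add: ip_commute)

lemma ip_nonneg: "0 \<le> ip Z Z"
  unfolding ip_def by simp

section \<open>Gram--Schmidt residuals and the Gaussian integral they control\<close>

text \<open>Gram--Schmidt residual of \<open>Z\<close> with respect to the values of \<open>Y\<close> at a list of points, the most
  recently added point first. If \<open>Y t\<close> is already in the span, division by \<open>0\<close> makes the step
  trivial.\<close>

primrec resid :: "'t list \<Rightarrow> ('u \<Rightarrow> real) \<Rightarrow> 'u \<Rightarrow> real" where
  "resid [] Z = Z"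
| "resid (t # ts) Z = (\<lambda>\<omega>. resid ts Z \<omega> +
     (- (ip (resid ts Z) (resid ts (Y t)) / ip (resid ts (Y t)) (resid ts (Y t)))) * resid ts (Y t) \<omega>)"

definition resid_var :: "'t list \<Rightarrow> 't \<Rightarrow> real" where
  "resid_var ts t = ip (resid ts (Y t)) (resid ts (Y t))"

lemma resid_lin: "Z \<in> lin \<Longrightarrow> resid ts Z \<in> lin"
proof (induction ts arbitrary: Z)
  case (Cons t ts)
  show ?case unfolding resid.simps by (rule lin_add) (use Cons lin_Y in auto)
qed simp

lemma resid_add:
  assumes "Z \<in> lin" "W \<in> lin"
  shows "resid ts (\<lambda>\<omega>. Z \<omega> + a * W \<omega>) = (\<lambda>\<omega>. resid ts Z \<omega> + a * resid ts W \<omega>)"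
proof (induction ts)
  case (Cons t ts)
  show ?case
    using assms lin_Y[of t]
    by (simp add: Cons ip_add_left resid_lin algebra_simps add_divide_distrib)
qed simp

text \<open>The residual is the error of some linear predictor; the comparison with the conditional
  variance in \<open>resid_var_ge\<close> rests on this form.\<close>

lemma resid_form: "\<exists>c. resid ts Z = (\<lambda>\<omega>. Z \<omega> - (\<Sum>s\<in>set ts. c s * Y s \<omega>))"
proof (induction ts arbitrary: Z)
  case (Cons t ts)
  obtain c where c: "resid ts Z = (\<lambda>\<omega>. Z \<omega> - (\<Sum>s\<in>set ts. c s * Y s \<omega>))" using Cons by blast
  obtain d where d: "resid ts (Y t) = (\<lambda>\<omega>. Y t \<omega> - (\<Sum>s\<in>set ts. d s * Y s \<omega>))" using Cons by blast
  define k where "k = - (ip (resid ts Z) (resid ts (Y t)) / ip (resid ts (Y t)) (resid ts (Y t)))"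
  have eq: "resid (t # ts) Z = (\<lambda>\<omega>. resid ts Z \<omega> + k * resid ts (Y t) \<omega>)"
    by (simp add: k_def)
  show ?case
  \<comment> \<open>The point \<open>t\<close> may already occur in \<open>ts\<close>; the two
    separate conditionals let its coefficients add up.\<close>
  proof (rule exI[where x = "\<lambda>s. (if s \<in> set ts then c s + k * d s else 0) - (if s = t then k else 0)"], rule ext)
    fix \<omega>
    have 1: "(\<Sum>s\<in>set (t # ts). (if s \<in> set ts then c s + k * d s else 0) * Y s \<omega>)
      = (\<Sum>s\<in>set ts. c s * Y s \<omega>) + k * (\<Sum>s\<in>set ts. d s * Y s \<omega>)"
      unfolding sum_distrib_left sum.distrib[symmetric]
      by (rule sum.mono_neutral_cong_right) (auto simp: algebra_simps)
    have 2: "(\<Sum>s\<in>set (t # ts). (if s = t then k else 0) * Y s \<omega>) = k * Y t \<omega>"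
      by (subst sum.mono_neutral_cong_right[of _ "{t}" _ "\<lambda>s. k * Y s \<omega>"]) auto
    show "resid (t # ts) Z \<omega> = Z \<omega> - (\<Sum>s\<in>set (t # ts).
      ((if s \<in> set ts then c s + k * d s else 0) - (if s = t then k else 0)) * Y s \<omega>)"
      unfolding left_diff_distrib sum_subtractf 1 2 eq c d by (simp add: algebra_simps)
  qed
qed simp

text \<open>Completing the square in \<open>a\<close>: with \<open>U\<close>, \<open>V\<close> the
  residuals of \<open>Z\<close> and \<open>Y t\<close>, the minimum of
  \<open>ip U U + 2 * a * ip U V + a\<^sup>2 * ip V V\<close> is the squared norm of the next
  residual, since that residual is \<open>U\<close> minus its projection onto
  \<open>V\<close>.\<close>

lemma ip_resid_add:
  assumes Z: "Z \<in> lin" and pos: "0 < resid_var ts t"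
  shows "ip (resid ts (\<lambda>\<omega>. Z \<omega> + a * Y t \<omega>)) (resid ts (\<lambda>\<omega>. Z \<omega> + a * Y t \<omega>)) =
    ip (resid (t # ts) Z) (resid (t # ts) Z)
      + resid_var ts t * (a + ip (resid ts Z) (resid ts (Y t)) / resid_var ts t)\<^sup>2"
proof -
  define U V where "U = resid ts Z" and "V = resid ts (Y t)"
  have UV: "U \<in> lin" "V \<in> lin" using Z lin_Y resid_lin by (auto simp: U_def V_def)
  have q: "ip (\<lambda>\<omega>. U \<omega> + k * V \<omega>) (\<lambda>\<omega>. U \<omega> + k * V \<omega>) = ip U U + 2 * k * ip U V + k\<^sup>2 * ip V V" for k
    using UV by (simp add: ip_add_left ip_add_right lin_add ip_commute[of V U] power2_eq_square algebra_simps)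
  have "0 < ip V V" using pos by (simp add: resid_var_def V_def)
  then show ?thesis
    unfolding resid_add[OF Z lin_Y] resid.simps U_def[symmetric] V_def[symmetric] q resid_var_def
    by (simp add: field_simps power2_eq_square)
qed

text \<open>Each factor is the Fourier transform of a standard normal variable \<open>u\<close>. Integrating over \<open>u\<close>
  last shifts \<open>Z\<close> by a multiple of \<open>Y t\<close>, which changes the residual variance quadratically.\<close>

lemma norm_char_gauss_le:
  assumes e: "0 < e" and pos: "\<And>us t vs. ts = us @ t # vs \<Longrightarrow> 0 < resid_var vs t" and Z: "Z \<in> lin"
  shows "norm (CLINT \<omega>|P. iexp (Z \<omega>) * of_real (\<Prod>t\<leftarrow>ts. exp (- ((Y t \<omega> - x) / e)\<^sup>2 / 2)))
    \<le> exp (- ip (resid ts Z) (resid ts Z) / 2) *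
       (\<Prod>k<length ts. e / sqrt (resid_var (drop (Suc k) ts) (ts ! k)))"
  using pos Z
proof (induction ts arbitrary: Z)
  case Nil
  then show ?case by (simp add: lin_char)
next
  case (Cons t ts)
  note Z = \<open>Z \<in> lin\<close>
  have v: "0 < resid_var ts t" using Cons.prems(1)[of "[]" t ts] by simp
  have IH: "norm (CLINT \<omega>|P. iexp (W \<omega>) * of_real (\<Prod>t\<leftarrow>ts. exp (- ((Y t \<omega> - x) / e)\<^sup>2 / 2)))
    \<le> exp (- ip (resid ts W) (resid ts W) / 2) *
       (\<Prod>k<length ts. e / sqrt (resid_var (drop (Suc k) ts) (ts ! k)))" if "W \<in> lin" for W
    by (rule Cons.IH[OF _ that]) (rule Cons.prems(1), simp)
  define K where "K = (\<Prod>k<length ts. e / sqrt (resid_var (drop (Suc k) ts) (ts ! k)))"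
  have K: "0 \<le> K" unfolding K_def using e by (intro prod_nonneg) (auto simp: resid_var_def ip_nonneg)
  define G where "G \<omega> = (\<Prod>t\<leftarrow>ts. exp (- ((Y t \<omega> - x) / e)\<^sup>2 / 2))" for \<omega>
  have G_meas [measurable]: "G \<in> borel_measurable P"
    unfolding G_def by (induction ts) auto
  have G: "0 \<le> G \<omega>" "G \<omega> \<le> 1" for \<omega>
    unfolding G_def by (induction ts) (auto intro!: mult_le_one)
  note [measurable] = lin_measurable[OF Z]
  let ?N = "std_normal_distribution"
  interpret N: prob_space ?N by (rule prob_space_normal_density) simp
  interpret NP: pair_prob_space ?N P ..
  let ?f = "\<lambda>u \<omega>. iexp (Z \<omega> + u * ((Y t \<omega> - x) / e)) * of_real (G \<omega>)"
  have "integrable (?N \<Otimes>\<^sub>M P) (\<lambda>(u, \<omega>). ?f u \<omega>)"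
  proof (rule NP.P.integrable_const_bound[where B = 1])
    show "AE p in ?N \<Otimes>\<^sub>M P. norm (case p of (u, \<omega>) \<Rightarrow> ?f u \<omega>) \<le> 1"
      using G by (intro AE_I2) (auto simp: norm_mult)
  qed measurable
  note fub = NP.Fubini_integral[OF this]
  \<comment> \<open>The Gaussian is a Fourier transform: the factor of the head \<open>t\<close>
    becomes an average over \<open>u\<close> of \<open>iexp (u * ((Y t \<omega> - x) / e))\<close>,
    which merges with \<open>iexp (Z \<omega>)\<close>.\<close>
  have char: "complex_of_real (exp (- s\<^sup>2 / 2)) = (CLINT u|?N. iexp (u * s))" for s
    using fun_cong[OF char_std_normal_distribution, of s] by (simp add: char_def mult.commute)
  have eq: "(CLINT \<omega>|P. iexp (Z \<omega>) * of_real (\<Prod>t\<leftarrow>t # ts. exp (- ((Y t \<omega> - x) / e)\<^sup>2 / 2)))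
    = (CLINT u|?N. (CLINT \<omega>|P. ?f u \<omega>))"
  proof -
    have "(CLINT \<omega>|P. iexp (Z \<omega>) * of_real (\<Prod>t\<leftarrow>t # ts. exp (- ((Y t \<omega> - x) / e)\<^sup>2 / 2)))
      = (CLINT \<omega>|P. (iexp (Z \<omega>) * of_real (G \<omega>)) * (CLINT u|?N. iexp (u * ((Y t \<omega> - x) / e))))"
      unfolding char[symmetric] by (simp add: G_def mult_ac)
    also have "\<dots> = (CLINT \<omega>|P. (CLINT u|?N. ?f u \<omega>))"
      by (subst integral_mult_right_zero[symmetric]) (simp add: distrib_left exp_add mult_ac)
    finally show ?thesis using fub by simp
  qed
  \<comment> \<open>After completing the square, the bound in \<open>u\<close> is a Gaussian with
    mean \<open>- c\<close> and standard deviation \<open>s\<close>; \<open>s\<close> is the factor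
    that the point \<open>t\<close> contributes to the product.\<close>
  define c s where "c = ip (resid ts Z) (resid ts (Y t)) / resid_var ts t * e" and "s = e / sqrt (resid_var ts t)"
  have s: "0 < s" using e v by (simp add: s_def)
  define q where "q = ip (resid (t # ts) Z) (resid (t # ts) Z)"
  have bd: "norm (CLINT \<omega>|P. ?f u \<omega>) \<le> exp (- (q + (u + c)\<^sup>2 / s\<^sup>2) / 2) * K" for u
  proof -
    \<comment> \<open>The part of the phase that contains \<open>x\<close> does not depend on
      \<open>\<omega>\<close> and has modulus one, so the bound is uniform in
      \<open>x\<close>.\<close>
    have "(CLINT \<omega>|P. ?f u \<omega>) = (CLINT \<omega>|P. iexp (- (u * x / e)) * (iexp (Z \<omega> + u / e * Y t \<omega>) * of_real (G \<omega>)))"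
      by (rule Bochner_Integration.integral_cong)
        (use e in \<open>auto simp: exp_add[symmetric] algebra_simps diff_divide_distrib\<close>)
    also have "norm \<dots> = norm (CLINT \<omega>|P. iexp (Z \<omega> + u / e * Y t \<omega>) * of_real (G \<omega>))"
      by (subst integral_mult_right_zero) (simp add: norm_mult)
    also have "\<dots> \<le> exp (- ip (resid ts (\<lambda>\<omega>. Z \<omega> + u / e * Y t \<omega>)) (resid ts (\<lambda>\<omega>. Z \<omega> + u / e * Y t \<omega>)) / 2) * K"
      unfolding G_def K_def by (rule IH) (rule lin_add[OF Z lin_Y])
    also have "ip (resid ts (\<lambda>\<omega>. Z \<omega> + u / e * Y t \<omega>)) (resid ts (\<lambda>\<omega>. Z \<omega> + u / e * Y t \<omega>))
      = q + (u + c)\<^sup>2 / s\<^sup>2"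
    proof -
      have "u / e + ip (resid ts Z) (resid ts (Y t)) / resid_var ts t = (u + c) / e"
        using e by (simp add: c_def field_simps)
      then show ?thesis
        unfolding ip_resid_add[OF Z v] q_def s_def using v by (simp add: power_divide)
    qed
    finally show ?thesis .
  qed
  have nonpos: "exp (- (q + (u + c)\<^sup>2 / s\<^sup>2) / 2) \<le> 1" for u
  proof -
    have "0 \<le> q + (u + c)\<^sup>2 / s\<^sup>2"
      by (intro add_nonneg_nonneg) (auto simp: q_def ip_nonneg)
    then show ?thesis by simp
  qed
  have "norm (CLINT u|?N. (CLINT \<omega>|P. ?f u \<omega>)) \<le> (\<integral>u. exp (- (q + (u + c)\<^sup>2 / s\<^sup>2) / 2) * K \<partial>?N)"
  proof (rule Bochner_Integration.integral_norm_bound_integral)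
    show "integrable ?N (\<lambda>u. exp (- (q + (u + c)\<^sup>2 / s\<^sup>2) / 2) * K)"
    proof (rule N.integrable_const_bound[where B = K])
      show "AE u in ?N. norm (exp (- (q + (u + c)\<^sup>2 / s\<^sup>2) / 2) * K) \<le> K"
      proof (rule AE_I2)
        fix u show "norm (exp (- (q + (u + c)\<^sup>2 / s\<^sup>2) / 2) * K) \<le> K"
          using mult_right_mono[OF nonpos[of u] K] K by (simp add: abs_mult)
      qed
    qed measurable
    show "integrable ?N (\<lambda>u. CLINT \<omega>|P. ?f u \<omega>)"
    proof (rule N.integrable_const_bound[where B = "1 * K"])
      show "AE u in ?N. norm (CLINT \<omega>|P. ?f u \<omega>) \<le> 1 * K"
        by (intro AE_I2 order_trans[OF bd] mult_right_mono nonpos K)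
    qed measurable
  qed (rule bd)
  also have "\<dots> = (\<integral>u. std_normal_density u * (exp (- (q + (u + c)\<^sup>2 / s\<^sup>2) / 2) * K) \<partial>lborel)"
    by (subst integral_density) auto
  \<comment> \<open>The standard normal density is bounded by its maximum
    \<open>1 / sqrt (2 * pi)\<close>; what remains is \<open>exp (- q / 2) * K * s\<close> times a
    normal density of total mass one.\<close>
  also have "\<dots> \<le> (\<integral>u. exp (- q / 2) * K * s * normal_density (- c) s u \<partial>lborel)"
  proof (rule integral_mono)
    show le: "std_normal_density u * (exp (- (q + (u + c)\<^sup>2 / s\<^sup>2) / 2) * K)
      \<le> exp (- q / 2) * K * s * normal_density (- c) s u" for u
    proof -
      have 1: "s * normal_density (- c) s u = 1 / sqrt (2 * pi) * exp (- (u + c)\<^sup>2 / (2 * s\<^sup>2))"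
        using s by (simp add: normal_density_def real_sqrt_mult)
      have e: "exp (- (q + (u + c)\<^sup>2 / s\<^sup>2) / 2) = exp (- q / 2) * exp (- (u + c)\<^sup>2 / (2 * s\<^sup>2))"
        unfolding exp_add[symmetric] by (simp add: field_simps)
      have "std_normal_density u \<le> 1 / sqrt (2 * pi)"
        unfolding std_normal_density_def by (simp add: divide_right_mono)
      then have "std_normal_density u * (exp (- (q + (u + c)\<^sup>2 / s\<^sup>2) / 2) * K)
        \<le> 1 / sqrt (2 * pi) * (exp (- (q + (u + c)\<^sup>2 / s\<^sup>2) / 2) * K)"
        using K by (intro mult_right_mono) auto
      also have "\<dots> = exp (- q / 2) * K * (s * normal_density (- c) s u)"
        unfolding 1 e by (simp only: mult_ac)
      finally show ?thesis by (simp only: mult.assoc)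
    qed
    show "integrable lborel (\<lambda>u. exp (- q / 2) * K * s * normal_density (- c) s u)"
      using s by simp
    then show "integrable lborel (\<lambda>u. std_normal_density u * (exp (- (q + (u + c)\<^sup>2 / s\<^sup>2) / 2) * K))"
    proof (rule Bochner_Integration.integrable_bound)
      show "AE u in lborel. norm (std_normal_density u * (exp (- (q + (u + c)\<^sup>2 / s\<^sup>2) / 2) * K))
        \<le> norm (exp (- q / 2) * K * s * normal_density (- c) s u)"
        using le K s by (intro AE_I2) (simp del: std_normal_density_def)
    qed measurable
  qed
  also have "\<dots> = exp (- q / 2) * (s * K)" using s by simp
  also have "s * K = (\<Prod>k<length (t # ts). e / sqrt (resid_var (drop (Suc k) (t # ts)) ((t # ts) ! k)))"
    by (simp add: prod.lessThan_Suc_shift s_def K_def del: prod.lessThan_Suc)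
  finally show ?case unfolding eq q_def .
qed

text \<open>On the event every \<open>exp (- ((Y t \<omega> - x) / e)\<^sup>2 / 2)\<close> is at
  least \<open>1 / 2\<close>, because \<open>exp (- 1 / 2) \<ge> 1 / 2\<close>. Hence the
  probability is at most \<open>2 ^ length ts\<close> times the mean of their product, which
  \<open>norm_char_gauss_le\<close> bounds by taking \<open>Z = 0\<close>.\<close>

lemma prob_small_ball_le:
  assumes e: "0 < e" and pos: "\<And>us t vs. ts = us @ t # vs \<Longrightarrow> 0 < resid_var vs t"
  shows "prob {\<omega> \<in> space P. \<forall>t\<in>set ts. \<bar>Y t \<omega> - x\<bar> \<le> e}
    \<le> (\<Prod>k<length ts. 2 * e / sqrt (resid_var (drop (Suc k) ts) (ts ! k)))"
proof -
  let ?A = "{\<omega> \<in> space P. \<forall>t\<in>set ts. \<bar>Y t \<omega> - x\<bar> \<le> e}"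
  define G where "G \<omega> = (\<Prod>t\<leftarrow>ts. exp (- ((Y t \<omega> - x) / e)\<^sup>2 / 2))" for \<omega>
  have [measurable]: "G \<in> borel_measurable P"
    unfolding G_def by (induction ts) auto
  have G: "0 \<le> G \<omega>" "G \<omega> \<le> 1" for \<omega>
    unfolding G_def by (induction ts) (auto intro!: mult_le_one)
  have intG: "integrable P G"
    by (rule integrable_const_bound[where B = 1]) (use G in auto)
  have half: "1 / 2 \<le> exp (- z\<^sup>2 / 2)" if "\<bar>z\<bar> \<le> 1" for z :: real
  proof -
    have "z\<^sup>2 \<le> 1" using that by (simp add: abs_square_le_1)
    then show ?thesis using exp_ge_add_one_self[of "- z\<^sup>2 / 2"] by simp
  qed
  have ind: "(1 / 2) ^ length ts \<le> G \<omega>" if "\<omega> \<in> ?A" for \<omega>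
  proof -
    have "\<forall>t\<in>set ts. \<bar>(Y t \<omega> - x) / e\<bar> \<le> 1" using that e by auto
    then show ?thesis unfolding G_def
    proof (induction ts)
      case (Cons t ts)
      have "1 / 2 * (1 / 2) ^ length ts \<le> exp (- ((Y t \<omega> - x) / e)\<^sup>2 / 2) * (\<Prod>t\<leftarrow>ts. exp (- ((Y t \<omega> - x) / e)\<^sup>2 / 2))"
        by (rule mult_mono[OF half]) (use Cons in auto)
      then show ?case by simp
    qed simp
  qed
  have "(1 / 2) ^ length ts * prob ?A = (\<integral>\<omega>. (1 / 2) ^ length ts * indicator ?A \<omega> \<partial>P)"
    by simp
  also have "\<dots> \<le> (\<integral>\<omega>. G \<omega> \<partial>P)"
    by (rule integral_mono) (use intG ind G in \<open>auto simp: indicator_def intro!: integrable_const_bound[where B = 1] power_le_one\<close>)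
  also have "\<dots> = norm (CLINT \<omega>|P. iexp ((\<lambda>\<omega>. 0) \<omega>) * of_real (G \<omega>))"
    using G by simp
  also have "\<dots> \<le> exp (- ip (resid ts (\<lambda>\<omega>. 0)) (resid ts (\<lambda>\<omega>. 0)) / 2) *
       (\<Prod>k<length ts. e / sqrt (resid_var (drop (Suc k) ts) (ts ! k)))"
    unfolding G_def by (rule norm_char_gauss_le[OF e pos lin_0])
  also have "\<dots> \<le> (\<Prod>k<length ts. e / sqrt (resid_var (drop (Suc k) ts) (ts ! k)))"
    using e by (intro mult_left_le_one_le prod_nonneg) (auto simp: resid_var_def ip_nonneg)
  finally have "(1 / 2) ^ length ts * prob ?A \<le> (\<Prod>k<length ts. e / sqrt (resid_var (drop (Suc k) ts) (ts ! k)))" .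
  then have "2 ^ length ts * ((1 / 2) ^ length ts * prob ?A)
    \<le> 2 ^ length ts * (\<Prod>k<length ts. e / sqrt (resid_var (drop (Suc k) ts) (ts ! k)))"
    by (intro mult_left_mono) auto
  also have "\<dots> = (\<Prod>k<length ts. 2 * e / sqrt (resid_var (drop (Suc k) ts) (ts ! k)))"
    by (simp add: prod.distrib flip: times_divide_eq_right)
  finally show ?thesis by (simp add: power_one_over)
qed


text \<open>\<open>resid ts (Y t)\<close> is the error of a predictor built from the values at
  \<open>u 1, ..., u n\<close>, and no such predictor has smaller mean square error than the
  conditional expectation.\<close>

lemma resid_var_ge:
  assumes u: "1 \<le> n" "set ts \<subseteq> u ` {1..n}"
    and c: "AE \<omega> in P. c \<le> cond_variance P (generated_by P Y n u) (Y t) \<omega>"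
  shows "c \<le> resid_var ts t"
proof -
  define F where "F = generated_by P Y n u"
  have [measurable]: "(\<lambda>\<omega>. \<lambda>k\<in>{1..n}. Y (u k) \<omega>) \<in> measurable P (\<Pi>\<^sub>M k\<in>{1..n}. borel)"
    by measurable
  have map: "(\<lambda>\<omega>. \<lambda>k\<in>{1..n}. Y (u k) \<omega>) \<in> measurable F (\<Pi>\<^sub>M k\<in>{1..n}. borel)"
    unfolding F_def generated_by_def by (rule measurable_vimage_algebra1) (auto simp: space_PiM)
  have YF: "Y s \<in> borel_measurable F" if s: "s \<in> set ts" for s
  proof -
    obtain k where k: "k \<in> {1..n}" "s = u k" using s u by auto
    have "(\<lambda>\<omega>. (\<lambda>k\<in>{1..n}. Y (u k) \<omega>) k) \<in> borel_measurable F"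
      using measurable_compose[OF map measurable_component_singleton[OF k(1)]] .
    then show ?thesis using k by simp
  qed
  have sub: "subalgebra P F"
    unfolding subalgebra_def F_def generated_by_def
    by (auto simp: sets_vimage_algebra2 space_PiM intro!: measurable_sets[of _ P])
  obtain a where a: "resid ts (Y t) = (\<lambda>\<omega>. Y t \<omega> - (\<Sum>s\<in>set ts. a s * Y s \<omega>))"
    using resid_form by blast
  have "c \<le> (\<integral>\<omega>. (Y t \<omega> - (\<Sum>s\<in>set ts. a s * Y s \<omega>))\<^sup>2 \<partial>P)"
  proof (rule cond_variance_le_integral_square[OF sub _ _ _ _ c[folded F_def]])
    show "(\<lambda>\<omega>. \<Sum>s\<in>set ts. a s * Y s \<omega>) \<in> borel_measurable F"
      by (intro borel_measurable_sum borel_measurable_times YF) auto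
  qed (auto intro!: lin_integrable lin_square_integrable lin_Y lin_sum)
  then show ?thesis by (simp add: resid_var_def ip_def a power2_eq_square)
qed

end

section \<open>Measurability, independence and iterated integration\<close>

text \<open>Induction on \<open>m\<close>: one factor of the power is written as an integral over
  \<open>t\<close>, exchanged with the integral over \<open>\<omega>\<close>, and \<open>t\<close>
  joins the list of fixed points. Its weight \<open>v ts t\<close> is then integrated out at the
  cost \<open>b (length ts)\<close>. The case of the empty list bounds the \<open>m\<close>-th
  moment.\<close>

lemma nn_integral_power_le:
  fixes f :: "'t \<Rightarrow> 'w \<Rightarrow> ennreal" and w :: "'t list \<Rightarrow> ennreal"
  assumes "sigma_finite_measure N" "sigma_finite_measure M"
    and f [measurable]: "case_prod f \<in> borel_measurable (N \<Otimes>\<^sub>M M)"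
    and A [measurable]: "A \<in> sets N" and f0: "\<And>t \<omega>. t \<notin> A \<Longrightarrow> f t \<omega> = 0"
    and w: "\<And>ts. set ts \<subseteq> A \<Longrightarrow> (\<integral>\<^sup>+\<omega>. (\<Prod>t\<leftarrow>ts. f t \<omega>) \<partial>M) \<le> w ts"
    and wv: "\<And>t ts. w (t # ts) = w ts * v ts t"
    and v [measurable]: "\<And>ts. v ts \<in> borel_measurable N"
    and b: "\<And>ts. set ts \<subseteq> A \<Longrightarrow> (\<integral>\<^sup>+t. v ts t * indicator A t \<partial>N) \<le> b (length ts)"
    and ts: "set ts \<subseteq> A" "set ts \<subseteq> space N"
  shows "(\<integral>\<^sup>+\<omega>. (\<Prod>t\<leftarrow>ts. f t \<omega>) * (\<integral>\<^sup>+t. f t \<omega> \<partial>N) ^ m \<partial>M) \<le> w ts * (\<Prod>i<m. b (length ts + i))"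
  using ts
proof (induction m arbitrary: ts)
  case 0
  then show ?case using w by simp
next
  case (Suc m)
  interpret N: sigma_finite_measure N by fact
  interpret M: sigma_finite_measure M by fact
  interpret NM: pair_sigma_finite N M ..
  define B where "B = (\<Prod>i<m. b (Suc (length ts) + i))"
  have fm [measurable]: "f t \<in> borel_measurable M" if "t \<in> space N" for t
    using measurable_compose[OF measurable_Pair1'[OF that] f] by simp
  have fm' [measurable]: "(\<lambda>t. f t \<omega>) \<in> borel_measurable N" if "\<omega> \<in> space M" for \<omega>
    using measurable_compose[OF measurable_Pair2'[OF that] f] by simp
  define g where "g \<omega> = (\<Prod>t\<leftarrow>ts. f t \<omega>) * (\<integral>\<^sup>+t. f t \<omega> \<partial>N) ^ m" for \<omega>
  have pm [measurable]: "(\<lambda>\<omega>. \<Prod>t\<leftarrow>ts. f t \<omega>) \<in> borel_measurable M"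
    using Suc.prems(2) by (induction ts) auto
  have "(\<lambda>p. f (snd p) (fst p)) \<in> borel_measurable (M \<Otimes>\<^sub>M N)"
    using measurable_compose[OF measurable_pair_swap' f] by (simp add: split_beta')
  then have [measurable]: "(\<lambda>\<omega>. \<integral>\<^sup>+t. f t \<omega> \<partial>N) \<in> borel_measurable M"
    by (intro N.borel_measurable_nn_integral) (simp add: split_beta')
  have [measurable]: "g \<in> borel_measurable M"
    unfolding g_def by measurable
  have "(\<integral>\<^sup>+\<omega>. (\<Prod>t\<leftarrow>ts. f t \<omega>) * (\<integral>\<^sup>+t. f t \<omega> \<partial>N) ^ Suc m \<partial>M)
    = (\<integral>\<^sup>+\<omega>. (\<integral>\<^sup>+t. f t \<omega> * g \<omega> \<partial>N) \<partial>M)"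
    by (intro nn_integral_cong) (simp add: nn_integral_multc g_def mult_ac)
  also have "\<dots> = (\<integral>\<^sup>+t. (\<integral>\<^sup>+\<omega>. f t \<omega> * g \<omega> \<partial>M) \<partial>N)"
    by (rule NM.Fubini') measurable
  also have "\<dots> \<le> (\<integral>\<^sup>+t. w ts * B * (v ts t * indicator A t) \<partial>N)"
  proof (rule nn_integral_mono)
    fix t assume t: "t \<in> space N"
    show "(\<integral>\<^sup>+\<omega>. f t \<omega> * g \<omega> \<partial>M) \<le> w ts * B * (v ts t * indicator A t)"
    proof (cases "t \<in> A")
      case True
      have "(\<integral>\<^sup>+\<omega>. f t \<omega> * g \<omega> \<partial>M) = (\<integral>\<^sup>+\<omega>. (\<Prod>t\<leftarrow>t # ts. f t \<omega>) * (\<integral>\<^sup>+t. f t \<omega> \<partial>N) ^ m \<partial>M)"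
        by (simp add: g_def mult_ac)
      also have "\<dots> \<le> w (t # ts) * (\<Prod>i<m. b (length (t # ts) + i))"
        by (rule Suc.IH) (use True t Suc.prems in auto)
      finally show ?thesis using True by (simp add: B_def wv mult_ac)
    qed (simp add: f0)
  qed
  also have "\<dots> = w ts * B * (\<integral>\<^sup>+t. v ts t * indicator A t \<partial>N)"
    by (rule nn_integral_cmult) measurable
  also have "\<dots> \<le> w ts * B * b (length ts)"
    by (intro mult_left_mono b) (use Suc.prems in auto)
  also have "\<dots> = w ts * (\<Prod>i<Suc m. b (length ts + i))"
    by (simp add: B_def prod.lessThan_Suc_shift mult_ac del: prod.lessThan_Suc)
  finally show ?case .
qed

section \<open>A jointly measurable version of a continuous field\<close>

lemma floor_grid_tendsto:
  fixes x :: real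
  shows "(\<lambda>m. of_int \<lfloor>real (Suc m) * x\<rfloor> / real (Suc m)) \<longlonglongrightarrow> x"
proof (rule real_tendsto_sandwich)
  show "(\<lambda>m. x - 1 / real (Suc m)) \<longlonglongrightarrow> x"
    using tendsto_diff[OF tendsto_const[of x] LIMSEQ_inverse_real_of_nat] by (simp add: inverse_eq_divide)
  show "\<forall>\<^sub>F m in sequentially. x - 1 / real (Suc m) \<le> of_int \<lfloor>real (Suc m) * x\<rfloor> / real (Suc m)"
  proof (rule always_eventually, rule allI)
    fix m
    have "real (Suc m) * x - 1 \<le> of_int \<lfloor>real (Suc m) * x\<rfloor>" by linarith
    then have "(real (Suc m) * x - 1) / real (Suc m) \<le> of_int \<lfloor>real (Suc m) * x\<rfloor> / real (Suc m)"
      by (intro divide_right_mono) auto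
    then show "x - 1 / real (Suc m) \<le> of_int \<lfloor>real (Suc m) * x\<rfloor> / real (Suc m)"
      by (simp add: diff_divide_distrib del: of_nat_Suc)
  qed
  show "\<forall>\<^sub>F m in sequentially. of_int \<lfloor>real (Suc m) * x\<rfloor> / real (Suc m) \<le> x"
  proof (rule always_eventually, rule allI)
    fix m
    have "of_int \<lfloor>real (Suc m) * x\<rfloor> / real (Suc m) \<le> (real (Suc m) * x) / real (Suc m)"
      by (intro divide_right_mono) linarith+
    then show "of_int \<lfloor>real (Suc m) * x\<rfloor> / real (Suc m) \<le> x" by (simp del: of_nat_Suc)
  qed
qed auto

text \<open>Rounding \<open>t\<close> down to the grid of mesh \<open>1 / Suc m\<close> leaves
  countably many parameters, so each approximation is jointly measurable. Along continuous paths the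
  approximations converge to \<open>X t \<omega>\<close>; elsewhere \<open>lim\<close> supplies a
  value that keeps \<open>Z\<close> measurable.\<close>

lemma continuous_field_measurable_modification:
  fixes X :: "real ^ 'n \<Rightarrow> 'w \<Rightarrow> 'v :: {banach, second_countable_topology}"
  assumes X [measurable]: "\<And>t. X t \<in> borel_measurable M" and cont: "continuous_field M X"
  obtains Z where "case_prod Z \<in> borel_measurable (borel \<Otimes>\<^sub>M M)" "AE \<omega> in M. \<forall>t. Z t \<omega> = X t \<omega>"
proof -
  define g :: "nat \<Rightarrow> real ^ 'n \<Rightarrow> 'n \<Rightarrow> int" where "g m t = (\<lambda>j. \<lfloor>real (Suc m) * t $ j\<rfloor>)" for m t
  define p :: "nat \<Rightarrow> ('n \<Rightarrow> int) \<Rightarrow> real ^ 'n" where "p m i = (\<chi> j. of_int (i j) / real (Suc m))" for m i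
  have g: "g m \<in> measurable borel (count_space UNIV)" for m
  proof (subst measurable_count_space_eq2_countable, intro conjI ballI)
    fix i :: "'n \<Rightarrow> int"
    have "g m -` {i} \<inter> space borel = {t. \<forall>j. \<lfloor>real (Suc m) * t $ j\<rfloor> = i j}"
      by (auto simp: g_def fun_eq_iff)
    also have "\<dots> \<in> sets borel" by measurable
    finally show "g m -` {i} \<inter> space borel \<in> sets borel" .
  qed auto
  define Z where "Z t \<omega> = lim (\<lambda>m. X (p m (g m t)) \<omega>)" for t \<omega>
  have meas: "(\<lambda>q. X (p m (g m (fst q))) (snd q)) \<in> borel_measurable (borel \<Otimes>\<^sub>M M)" for m
    by (rule measurable_compose_countable[where f = "\<lambda>i q. X (p m i) (snd q)" and g = "\<lambda>q. g m (fst q)"])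
      (auto intro: measurable_compose[OF measurable_fst g])
  have "case_prod Z \<in> borel_measurable (borel \<Otimes>\<^sub>M M)"
    unfolding Z_def split_beta' by (intro borel_measurable_lim_metric meas)
  moreover have "AE \<omega> in M. \<forall>t. Z t \<omega> = X t \<omega>"
    using cont unfolding continuous_field_def
  proof eventually_elim
    case (elim \<omega>)
    show ?case
    proof
      fix t
      have "(\<lambda>m. p m (g m t)) \<longlonglongrightarrow> t"
        by (rule vec_tendstoI) (simp add: p_def g_def floor_grid_tendsto del: of_nat_Suc)
      then have "(\<lambda>m. X (p m (g m t)) \<omega>) \<longlonglongrightarrow> X t \<omega>"
        by (rule continuous_on_tendsto_compose[OF elim]) auto
      then show "Z t \<omega> = X t \<omega>" unfolding Z_def by (rule limI)
    qed
  qed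
  ultimately show thesis by (rule that)
qed

section \<open>Transfer between \<open>Y\<close> and the coordinates of \<open>X\<close>\<close>

lemma space_PiM_UNIV_borel: "space (\<Pi>\<^sub>M t\<in>UNIV. borel) = UNIV"
  by (auto simp: space_PiM)

lemma measurable_path:
  assumes "\<And>t. Y t \<in> borel_measurable P"
  shows "(\<lambda>\<omega> t. Y t \<omega>) \<in> measurable P (\<Pi>\<^sub>M t\<in>UNIV. borel)"
  by (rule measurable_PiM_single') (use assms in auto)

text \<open>Evaluation at \<open>t\<close> is measurable on path space, so the mean is determined by
  the law of the process, which \<open>Y\<close> shares with each coordinate of
  \<open>X\<close>.\<close>

lemma iid_copies_mean_zero:
  fixes X :: "'t \<Rightarrow> 'w \<Rightarrow> real ^ 'd"
  assumes iid: "iid_copies M X P Y" and X [measurable]: "\<And>t. X t \<in> borel_measurable M"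
    and Y [measurable]: "\<And>t. Y t \<in> borel_measurable P" and mz: "mean_zero M X"
  shows "mean_zero P Y"
  unfolding mean_zero_def
proof
  fix t
  let ?B = "\<Pi>\<^sub>M t\<in>(UNIV :: 't set). (borel :: real measure)"
  obtain j :: 'd where True by simp
  have eq: "distr M ?B (\<lambda>\<omega> t. X t \<omega> $ j) = distr P ?B (\<lambda>\<omega> t. Y t \<omega>)"
    using iid by (auto simp: iid_copies_def)
  have mX: "(\<lambda>\<omega> t. X t \<omega> $ j) \<in> measurable M ?B" 
    by (rule measurable_path, rule measurable_compose[OF X])
      (auto intro: borel_measurable_continuous_onI continuous_intros)
  have mY: "(\<lambda>\<omega> t. Y t \<omega>) \<in> measurable P ?B" by (rule measurable_path) measurable
  have c: "(\<lambda>f. f t) \<in> borel_measurable ?B" by (rule measurable_component_singleton) simp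
  have iX: "integrable M (\<lambda>\<omega>. X t \<omega> $ j)" "(\<integral>\<omega>. X t \<omega> $ j \<partial>M) = 0"
  proof -
    have "integrable M (X t)" "integral\<^sup>L M (X t) = 0" using mz by (auto simp: mean_zero_def)
    then show "integrable M (\<lambda>\<omega>. X t \<omega> $ j)" "(\<integral>\<omega>. X t \<omega> $ j \<partial>M) = 0"
      using integrable_bounded_linear[OF bounded_linear_vec_nth, of M "X t" j]
        integral_bounded_linear[OF bounded_linear_vec_nth, of M "X t" j] by auto
  qed
  have "integrable (distr M ?B (\<lambda>\<omega> t. X t \<omega> $ j)) (\<lambda>f. f t)"
    by (subst integrable_distr_eq[OF mX c]) (use iX in simp)
  then have "integrable P (Y t)"
    unfolding eq by (subst (asm) integrable_distr_eq[OF mY c])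
  moreover have "integral\<^sup>L (distr M ?B (\<lambda>\<omega> t. X t \<omega> $ j)) (\<lambda>f. f t) = 0"
    by (subst integral_distr[OF mX c]) (use iX in simp)
  then have "integral\<^sup>L P (Y t) = 0"
    unfolding eq by (subst (asm) integral_distr[OF mY c])
  ultimately show "integrable P (Y t) \<and> integral\<^sup>L P (Y t) = 0" by simp
qed

text \<open>The event is an intersection over \<open>j\<close> of cylinder events for the coordinate
  processes. Independence turns its probability into a product, and equality of laws replaces each
  coordinate by \<open>Y\<close>.\<close>

lemma iid_copies_prob_cube:
  fixes X :: "'t \<Rightarrow> 'w \<Rightarrow> real ^ 'd"
  assumes "prob_space M" and iid: "iid_copies M X P Y"
    and X [measurable]: "\<And>t. X t \<in> borel_measurable M"
    and Y [measurable]: "\<And>t. Y t \<in> borel_measurable P"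
  shows "measure M {\<omega> \<in> space M. \<forall>t\<in>set ts. \<forall>j. \<bar>X t \<omega> $ j - x $ j\<bar> \<le> e}
    = (\<Prod>j\<in>UNIV. measure P {\<omega> \<in> space P. \<forall>t\<in>set ts. \<bar>Y t \<omega> - x $ j\<bar> \<le> e})"
proof -
  interpret prob_space M by fact
  let ?B = "\<Pi>\<^sub>M t\<in>(UNIV :: 't set). (borel :: real measure)"
  define A where "A j = {f \<in> space ?B. \<forall>t\<in>set ts. \<bar>f t - x $ j\<bar> \<le> e}" for j
  have A: "A j \<in> sets ?B" for j
    unfolding A_def by measurable
  have indep: "indep_vars (\<lambda>_. ?B) (\<lambda>j \<omega> t. X t \<omega> $ j) UNIV"
    and eq: "distr M ?B (\<lambda>\<omega> t. X t \<omega> $ j) = distr P ?B (\<lambda>\<omega> t. Y t \<omega>)" for j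
    using iid by (auto simp: iid_copies_def)
  have mX: "(\<lambda>\<omega> t. X t \<omega> $ j) \<in> measurable M ?B" for j 
    by (rule measurable_path, rule measurable_compose[OF X])
      (auto intro: borel_measurable_continuous_onI continuous_intros)
  have mY: "(\<lambda>\<omega> t. Y t \<omega>) \<in> measurable P ?B" by (rule measurable_path) measurable
  have "{\<omega> \<in> space M. \<forall>t\<in>set ts. \<forall>j. \<bar>X t \<omega> $ j - x $ j\<bar> \<le> e}
    = (\<Inter>j\<in>UNIV. (\<lambda>\<omega> t. X t \<omega> $ j) -` A j \<inter> space M)"
    by (auto simp: A_def space_PiM_UNIV_borel)
  also have "prob \<dots> = (\<Prod>j\<in>UNIV. prob ((\<lambda>\<omega> t. X t \<omega> $ j) -` A j \<inter> space M))"
    by (rule indep_varsD_finite[OF indep]) (use A in auto)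
  also have "\<dots> = (\<Prod>j\<in>UNIV. measure P ((\<lambda>\<omega> t. Y t \<omega>) -` A j \<inter> space P))"
    using measure_distr[OF mX A] measure_distr[OF mY A] eq by simp
  also have "\<dots> = (\<Prod>j\<in>UNIV. measure P {\<omega> \<in> space P. \<forall>t\<in>set ts. \<bar>Y t \<omega> - x $ j\<bar> \<le> e})"
    by (intro prod.cong refl arg_cong[where f = "measure P"]) (auto simp: A_def space_PiM_UNIV_borel)
  finally show ?thesis .
qed

section \<open>Local times and occupation measures of cubes\<close>

lemma emeasure_cube:
  fixes x :: "real ^ 'd"
  assumes "0 < e"
  shows "emeasure lborel (cbox (\<chi> j. x $ j - e) (\<chi> j. x $ j + e)) = ennreal ((2 * e) ^ CARD('d))"
proof -
  have "x $ j + e - (x $ j - e) = 2 * e" for j by simp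
  then show ?thesis using assms by (subst emeasure_lborel_cbox_cart) simp_all
qed

lemma mem_cube:
  fixes x y :: "real ^ 'd"
  shows "y \<in> cbox (\<chi> j. x $ j - e) (\<chi> j. x $ j + e) \<longleftrightarrow> (\<forall>j. \<bar>y $ j - x $ j\<bar> \<le> e)"
proof -
  have "x $ j - e \<le> y $ j \<and> y $ j \<le> x $ j + e \<longleftrightarrow> \<bar>y $ j - x $ j\<bar> \<le> e" for j
    by (intro iffI conjI; linarith)
  then show ?thesis by (simp add: mem_box_cart)
qed

text \<open>\<open>K\<close> lists the coordinates in which the lower face is already cut off:
  \<open>K = {}\<close> gives boxes anchored at the lower corner of \<open>T\<close>,
  \<open>K = UNIV\<close> half-open boxes. Strict lower inequalities make each cut a difference of
  two such sets.\<close>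

definition halfopen :: "(real ^ 'n) set \<Rightarrow> 'n set \<Rightarrow> real ^ 'n \<Rightarrow> real ^ 'n \<Rightarrow> (real ^ 'n) set" where
  "halfopen T K a b = {t \<in> T. (\<forall>j\<in>K. a $ j < t $ j) \<and> (\<forall>j. t $ j \<le> b $ j)}"

lemma halfopen_borel:
  assumes [measurable]: "T \<in> sets borel"
  shows "halfopen T K a b \<in> sets borel"
proof -
  have "halfopen T K a b = {t \<in> space borel. t \<in> T \<and> (\<forall>j. j \<in> K \<longrightarrow> a $ j < t $ j) \<and> (\<forall>j. t $ j \<le> b $ j)}"
    by (auto simp: halfopen_def)
  also have "\<dots> \<in> sets borel" by measurable
  finally show ?thesis .
qed

text \<open>Joint continuity only concerns boxes anchored at \<open>\<tau>\<close>; the lower faces are cut off one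
  coordinate at a time.\<close>

lemma continuous_on_measure_halfopen:
  fixes l :: "'x::topological_space \<Rightarrow> (real ^ 'n) measure"
  assumes l: "\<And>y. sets (l y) = sets borel" "\<And>y. finite_measure (l y)"
    and T: "T \<in> sets borel" "T \<subseteq> cbox \<tau> (\<tau> + h)"
    and cont: "\<And>s. s \<in> cbox 0 h \<Longrightarrow> continuous_on UNIV (\<lambda>y. measure (l y) (T \<inter> cbox \<tau> (\<tau> + s)))"
    and b: "b \<in> cbox \<tau> (\<tau> + h)"
  shows "continuous_on UNIV (\<lambda>y. measure (l y) (halfopen T K a b))"
proof -
  have lower: "\<tau> $ j \<le> t $ j" if "t \<in> T" for t j
    using that T(2) by (auto simp: mem_box_cart)
  show ?thesis
    using finite[of K] b
  proof (induction K arbitrary: b)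
    case empty
    have "halfopen T {} a b = T \<inter> cbox \<tau> (\<tau> + (b - \<tau>))"
      using lower by (auto simp: halfopen_def mem_box_cart)
    moreover have "b - \<tau> \<in> cbox 0 h"
      using empty by (simp add: mem_box_cart algebra_simps)
    ultimately show ?case using cont[of "b - \<tau>"] by simp
  next
    case (insert k K)
    show ?case
    proof (cases "a $ k < \<tau> $ k")
      \<comment> \<open>A cut below the lower corner removes nothing from \<open>T\<close>, whereas
        the corner \<open>b'\<close> used in the other case would leave the box.\<close>
      case True
      then have "halfopen T (insert k K) a b = halfopen T K a b"
        by (auto simp: halfopen_def intro: less_le_trans[OF _ lower])
      then show ?thesis using insert by simp
    next
      case False
      \<comment> \<open>Subtracting the set with upper corner \<open>b'\<close> removes exactly the
        points whose \<open>k\<close>-th coordinate is at most \<open>a $ k\<close>. The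
        \<open>min\<close> keeps \<open>b'\<close> in the box also when
        \<open>b $ k < a $ k\<close>.\<close>
      define b' where "b' = (\<chi> j. if j = k then min (a $ k) (b $ k) else b $ j)"
      have b': "b' \<in> cbox \<tau> (\<tau> + h)"
        using insert.prems False by (auto simp: b'_def mem_box_cart min_le_iff_disj)
      have sub: "halfopen T K a b' \<subseteq> halfopen T K a b"
        by (auto simp: halfopen_def b'_def split: if_splits)
      have eq: "halfopen T (insert k K) a b = halfopen T K a b - halfopen T K a b'"
      proof safe
        fix t assume t: "t \<in> halfopen T (insert k K) a b"
        then show "t \<in> halfopen T K a b" by (auto simp: halfopen_def)
        assume "t \<in> halfopen T K a b'"
        then have "t $ k \<le> b' $ k" by (auto simp: halfopen_def)
        with t show False by (auto simp: halfopen_def b'_def)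
      next
        fix t assume t: "t \<in> halfopen T K a b" "t \<notin> halfopen T K a b'"
        then obtain j where "\<not> t $ j \<le> b' $ j" by (auto simp: halfopen_def)
        with t(1) have "j = k" "a $ k < t $ k" by (auto simp: halfopen_def b'_def split: if_splits)
        with t(1) show "t \<in> halfopen T (insert k K) a b" by (auto simp: halfopen_def)
      qed
      have "measure (l y) (halfopen T (insert k K) a b)
        = measure (l y) (halfopen T K a b) - measure (l y) (halfopen T K a b')" for y
        unfolding eq using l sub halfopen_borel[OF T(1)] by (intro finite_measure.finite_measure_Diff) auto
      then show ?thesis
        using insert.IH[OF insert.prems] insert.IH[OF b'] by (simp add: continuous_on_diff)
    qed
  qed
qed

text \<open>The integral under the power is the occupation measure of a cube divided by its volume,
  an average of the local time near \<open>x\<close>. By continuity it is eventually at least any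
  \<open>r\<close> below \<open>measure (l x) S\<close>. A lower bound in the limit is what Fatou's
  lemma asks for.\<close>

lemma local_time_power_le_liminf:
  fixes f :: "real ^ 'n \<Rightarrow> real ^ 'd" and l :: "real ^ 'd \<Rightarrow> (real ^ 'n) measure"
  assumes f: "continuous_on UNIV f" and S: "S \<in> sets borel"
    and version: "local_time_version f S (\<lambda>y. emeasure (l y) S)"
    and fin: "\<And>y. finite_measure (l y)" and cont: "continuous_on UNIV (\<lambda>y. measure (l y) S)"
    and e: "\<And>k. 0 < e k" "e \<longlonglongrightarrow> 0"
  shows "emeasure (l x) S ^ n \<le> liminf (\<lambda>k. (\<integral>\<^sup>+t. indicator S t *
     indicator (cbox (\<chi> j. x $ j - e k) (\<chi> j. x $ j + e k)) (f t) * ennreal (1 / (2 * e k) ^ CARD('d)) \<partial>lborel) ^ n)"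
proof -
  define Q where "Q k = cbox (\<chi> j. x $ j - e k) (\<chi> j. x $ j + e k)" for k
  define A where "A k = (\<integral>\<^sup>+t. indicator S t * indicator (Q k) (f t) * ennreal (1 / (2 * e k) ^ CARD('d)) \<partial>lborel)" for k
  have Q [measurable]: "Q k \<in> sets borel" for k by (simp add: Q_def)
  have f' [measurable]: "f \<in> borel_measurable borel" using f by (rule borel_measurable_continuous_onI)
  note [measurable] = S
  define \<mu> where "\<mu> = occupation_measure f S"
  \<comment> \<open>The local time agrees with the Radon--Nikodym derivative almost everywhere,
    hence is itself a density of the occupation measure.\<close>
  have emu: "emeasure \<mu> B = (\<integral>\<^sup>+y. emeasure (l y) S * indicator B y \<partial>lborel)" if B: "B \<in> sets borel" for B
  proof -
    have "absolutely_continuous lborel \<mu>" "sets \<mu> = sets lborel"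
      using version by (auto simp: local_time_version_def \<mu>_def occupation_measure_def)
    then have "\<mu> = density lborel (RN_deriv lborel \<mu>)" by (simp add: sigma_finite_measure.density_RN_deriv[OF sigma_finite_lborel])
    then have "emeasure \<mu> B = emeasure (density lborel (RN_deriv lborel \<mu>)) B" by simp
    also have "\<dots> = (\<integral>\<^sup>+y. RN_deriv lborel \<mu> y * indicator B y \<partial>lborel)"
      using B by (intro emeasure_density) auto
    also have "\<dots> = (\<integral>\<^sup>+y. emeasure (l y) S * indicator B y \<partial>lborel)"
      by (rule nn_integral_cong_AE)
        (use version in \<open>auto simp: local_time_version_def \<mu>_def elim!: eventually_mono\<close>)
    finally show ?thesis .
  qed
  have A: "A k = emeasure \<mu> (Q k) * ennreal (1 / (2 * e k) ^ CARD('d))" for k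
  proof -
    have "emeasure \<mu> (Q k) = emeasure (restrict_space lborel S) (f -` Q k \<inter> space (restrict_space lborel S))"
      unfolding \<mu>_def occupation_measure_def
      by (rule emeasure_distr) (auto intro!: measurable_restrict_space1)
    also have "\<dots> = emeasure lborel (f -` Q k \<inter> S)"
      by (subst emeasure_restrict_space) (auto simp: space_restrict_space Int_commute)
    also have "\<dots> = (\<integral>\<^sup>+t. indicator S t * indicator (Q k) (f t) \<partial>lborel)"
    proof -
      have "f -` Q k \<inter> S = {t \<in> space borel. f t \<in> Q k \<and> t \<in> S}" by auto
      also have "\<dots> \<in> sets borel" by measurable
      finally have "f -` Q k \<inter> S \<in> sets lborel" by simp
      then have "emeasure lborel (f -` Q k \<inter> S) = (\<integral>\<^sup>+t. indicator (f -` Q k \<inter> S) t \<partial>lborel)"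
        by simp
      also have "\<dots> = (\<integral>\<^sup>+t. indicator S t * indicator (Q k) (f t) \<partial>lborel)"
        by (intro nn_integral_cong) (auto simp: indicator_def)
      finally show ?thesis .
    qed
    finally show ?thesis by (simp add: A_def nn_integral_multc)
  qed
  define m where "m = measure (l x) S"
  have em: "emeasure (l y) S = ennreal (measure (l y) S)" for y
    using fin[of y] by (simp add: finite_measure.emeasure_eq_measure)
  have ev: "\<forall>\<^sub>F k in sequentially. ennreal r \<le> A k" if r: "r < m" for r
  proof -
    have "\<forall>\<^sub>F y in nhds x. r < measure (l y) S"
      using cont r unfolding m_def
      by (intro order_tendstoD(1)[OF continuous_on_tendsto_compose[OF cont, of "\<lambda>y. y" x]])
         (auto simp: filterlim_ident)
    then obtain \<delta> where \<delta>: "0 < \<delta>" "\<And>y. dist y x < \<delta> \<Longrightarrow> r < measure (l y) S"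
      by (auto simp: eventually_nhds_metric)
    \<comment> \<open>In a cube of half side \<open>e k\<close> the distance to the centre is at
      most \<open>CARD('d) * e k\<close>, by the l1 norm.\<close>
    have "(\<lambda>k. real CARD('d) * e k) \<longlonglongrightarrow> 0" using tendsto_mult_right_zero[OF e(2)] by simp
    then have "\<forall>\<^sub>F k in sequentially. real CARD('d) * e k < \<delta>" using \<delta>(1) by (rule order_tendstoD)
    then show ?thesis
    proof eventually_elim
      case (elim k)
      have large: "r < measure (l y) S" if "y \<in> Q k" for y
      proof (rule \<delta>(2))
        have "dist y x \<le> (\<Sum>j\<in>UNIV. \<bar>(y - x) $ j\<bar>)" unfolding dist_norm by (rule norm_le_l1_cart)
        also have "\<dots> \<le> (\<Sum>j\<in>(UNIV::'d set). e k)"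
          using that by (intro sum_mono) (auto simp: Q_def mem_cube)
        finally show "dist y x < \<delta>" using elim by simp
      qed
      have "ennreal r = ennreal r * ennreal ((2 * e k) ^ CARD('d)) * ennreal (1 / (2 * e k) ^ CARD('d))"
        using e(1)[of k] by (simp add: mult.assoc ennreal_mult[symmetric])
      also have "ennreal r * ennreal ((2 * e k) ^ CARD('d)) = (\<integral>\<^sup>+y. ennreal r * indicator (Q k) y \<partial>lborel)"
        using emeasure_cube[OF e(1)[of k], of x] by (simp add: nn_integral_cmult_indicator Q_def)
      also have "\<dots> \<le> (\<integral>\<^sup>+y. emeasure (l y) S * indicator (Q k) y \<partial>lborel)"
        by (intro nn_integral_mono) (auto simp: indicator_def em intro!: ennreal_leI less_imp_le large)
      also have "\<dots> = emeasure \<mu> (Q k)" by (simp add: emu)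
      finally show ?case by (simp add: A mult_right_mono)
    qed
  qed
  \<comment> \<open>For \<open>m > 0\<close> the levels \<open>m * (1 - 1 / Suc i)\<close> lie below
    \<open>m\<close> and tend to it; \<open>m = 0\<close> is handled apart.\<close>
  have "(\<lambda>i. ennreal ((m * (1 - 1 / real (Suc i))) ^ n)) \<longlonglongrightarrow> ennreal ((m * (1 - 0)) ^ n)"
    using LIMSEQ_inverse_real_of_nat
    by (intro tendsto_ennrealI tendsto_intros) (simp add: inverse_eq_divide)
  moreover have "ennreal ((m * (1 - 1 / real (Suc i))) ^ n) \<le> liminf (\<lambda>k. A k ^ n)" for i
  proof (cases "m = 0")
    case True
    then show ?thesis by (cases n) (auto simp: one_ennreal_def[symmetric] Liminf_const)
  next
    case False
    then have m: "0 < m" by (simp add: m_def less_le)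
    define r where "r = m * (1 - 1 / real (Suc i))"
    have r: "0 \<le> r" "r < m" using m by (auto simp: r_def field_simps)
    have "\<forall>\<^sub>F k in sequentially. ennreal r ^ n \<le> A k ^ n"
      using ev[OF r(2)] by eventually_elim (rule power_mono, auto)
    then have "ennreal r ^ n \<le> liminf (\<lambda>k. A k ^ n)"
      by (rule Liminf_bounded)
    then show ?thesis using r by (simp add: ennreal_power r_def)
  qed
  ultimately have "ennreal ((m * (1 - 0)) ^ n) \<le> liminf (\<lambda>k. A k ^ n)"
    by (intro LIMSEQ_le_const2) auto
  then show ?thesis unfolding em A_def Q_def m_def by (simp add: ennreal_power)
qed

section \<open>Moments of occupation measures\<close>

text \<open>\<open>(i + 2) powr q \<le> 2 * (i + 1) powr q\<close> since \<open>q \<le> 1\<close>,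
  so the product of these powers is at most \<open>2 ^ n * fact n powr q\<close>. The shift by 2
  accounts for the origin and a fixed point of \<open>T\<close>, which are present from the start of
  the iterated integration.\<close>

lemma prod_powr_le_fact:
  fixes c l p q :: real
  assumes c: "0 \<le> c" and l: "0 \<le> l" and q: "0 \<le> q" "q \<le> 1" and n: "1 \<le> n"
  shows "(\<Prod>i<n. c * (real (i + 2) powr q * l powr p)) \<le> (2 * c) ^ n * fact n powr q * l powr (n * p)"
proof -
  have *: "(\<Prod>i<m. real (i + 2) powr q) \<le> 2 ^ m * fact m powr q" for m
  proof (induction m)
    case (Suc m)
    have "real (m + 2) powr q \<le> (2 * real (Suc m)) powr q"
      using q by (intro powr_mono2) auto
    also have "\<dots> = 2 powr q * real (Suc m) powr q" by (rule powr_mult)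
    also have "\<dots> \<le> 2 powr 1 * real (Suc m) powr q"
      using q by (intro mult_right_mono powr_mono) auto
    finally have "(\<Prod>i<m. real (i + 2) powr q) * real (m + 2) powr q
      \<le> 2 ^ m * fact m powr q * (2 * real (Suc m) powr q)"
      using Suc by (intro mult_mono) (auto intro!: prod_nonneg)
    also have "\<dots> = 2 ^ Suc m * fact (Suc m) powr q"
      by (simp add: powr_mult mult_ac)
    finally show ?case by simp
  qed simp
  have "(\<Prod>i<n. c * (real (i + 2) powr q * l powr p)) = c ^ n * (\<Prod>i<n. real (i + 2) powr q) * (l powr p) ^ n"
    by (simp add: prod.distrib)
  also have "\<dots> \<le> c ^ n * (2 ^ n * fact n powr q) * (l powr p) ^ n"
    using c by (intro mult_right_mono mult_left_mono *) auto
  \<comment> \<open>With \<open>l = 0\<close> this uses \<open>n \<ge> 1\<close>: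
    \<open>0 powr y\<close> is \<open>0\<close> for every \<open>y\<close>, while a zeroth power is
    \<open>1\<close>.\<close>
  also have "(l powr p) ^ n = l powr (n * p)"
    using n l by (cases "l = 0") (auto simp: powr_power mult.commute power_0_left)
  finally show ?thesis by (simp add: power_mult_distrib mult_ac)
qed

text \<open>The origin is the point \<open>t\<^sup>0\<close> of condition (A2). Since that condition starts at \<open>n = 1\<close>, a fixed
  point \<open>s\<close> of \<open>T\<close> keeps the conditioning set nonempty when \<open>ts\<close> is empty.\<close>

definition min_rho :: "real ^ 'n \<Rightarrow> real ^ 'n \<Rightarrow> (real ^ 'n) list \<Rightarrow> real ^ 'n \<Rightarrow> real" where
  "min_rho H s ts t = Min (rho H t ` set (0 # s # ts))"

lemma min_rho_nonneg: "0 \<le> min_rho H s ts t"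
  unfolding min_rho_def by (subst Min_ge_iff) auto

lemma min_rho_measurable [measurable]: "(\<lambda>t. min_rho H s ts t) \<in> borel_measurable borel"
  unfolding min_rho_def by (rule borel_measurable_Min) auto

text \<open>(A2), applied to \<open>s\<close> followed by \<open>ts\<close>, bounds the conditional
  variance from below by a multiple of the squared minimal distance, and \<open>resid_var_ge\<close>
  passes this to the residual variance. Adding \<open>s\<close> to the conditioning points can only
  lower the bound.\<close>

lemma condition_A_resid_var:
  fixes Y :: "real ^ 'n \<Rightarrow> 'u \<Rightarrow> real"
  assumes "centered_gaussian_field P Y" and A: "condition_A P Y T H" and s: "s \<in> T"
  obtains c where "0 < c"
    "\<And>ts t. set ts \<subseteq> T \<Longrightarrow> t \<in> T \<Longrightarrow> (c * min_rho H s ts t)\<^sup>2 \<le> centered_gaussian_field.resid_var P Y ts t"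
proof -
  interpret centered_gaussian_field P Y by fact
  obtain C3 where C3: "0 < C3" and cv: "\<And>n t u. 1 \<le> n \<Longrightarrow> t \<in> T \<Longrightarrow> u 0 = 0 \<Longrightarrow> (\<forall>k\<in>{1..n}. u k \<in> T) \<Longrightarrow>
       AE \<omega> in P. cond_variance P (generated_by P Y n u) (Y t) \<omega> \<ge> C3 * (MIN k\<in>{0..n}. (rho H t (u k))\<^sup>2)"
    using A unfolding condition_A_def by blast
  show thesis
  proof (rule that[of "sqrt C3"])
    fix ts t assume ts: "set ts \<subseteq> T" and t: "t \<in> T"
    \<comment> \<open>Index \<open>0\<close> is the origin, as (A2) demands, index \<open>1\<close>
      is \<open>s\<close>, and \<open>ts\<close> starts at index \<open>2\<close>.\<close>
    define u where "u k = (0 # s # ts) ! k" for k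
    let ?n = "Suc (length ts)"
    have uT: "u k \<in> T" if k: "k \<in> {1..?n}" for k
    proof -
      obtain i where i: "k = Suc i" using k by (cases k) auto
      then have "i < length (s # ts)" using k by auto
      with i have "u k \<in> set (s # ts)" unfolding u_def by (metis nth_Cons_Suc nth_mem)
      then show ?thesis using s ts by auto
    qed
    have im: "set ts \<subseteq> u ` {1..?n}"
    proof
      fix v assume "v \<in> set ts"
      then obtain i where "i < length ts" "v = ts ! i" by (auto simp: in_set_conv_nth)
      then show "v \<in> u ` {1..?n}" by (intro image_eqI[of _ _ "Suc (Suc i)"]) (auto simp: u_def)
    qed
    have le: "(sqrt C3 * min_rho H s ts t)\<^sup>2 \<le> C3 * (MIN k\<in>{0..?n}. (rho H t (u k))\<^sup>2)"
    proof -
      have "(min_rho H s ts t)\<^sup>2 \<le> (rho H t (u k))\<^sup>2" if "k \<in> {0..?n}" for k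
      proof (rule power_mono[OF _ min_rho_nonneg])
        have "u k \<in> set (0 # s # ts)" using that unfolding u_def by (intro nth_mem) auto
        then show "min_rho H s ts t \<le> rho H t (u k)" unfolding min_rho_def by (intro Min_le) auto
      qed
      then have "(min_rho H s ts t)\<^sup>2 \<le> (MIN k\<in>{0..?n}. (rho H t (u k))\<^sup>2)"
        by (subst Min_ge_iff) auto
      then show ?thesis using C3 by (simp add: power_mult_distrib)
    qed
    have "AE \<omega> in P. C3 * (MIN k\<in>{0..?n}. (rho H t (u k))\<^sup>2) \<le> cond_variance P (generated_by P Y ?n u) (Y t) \<omega>"
      by (rule cv) (use t uT in \<open>auto simp: u_def\<close>)
    then have ae: "AE \<omega> in P. (sqrt C3 * min_rho H s ts t)\<^sup>2 \<le> cond_variance P (generated_by P Y ?n u) (Y t) \<omega>"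
      by eventually_elim (rule order_trans[OF le])
    show "(sqrt C3 * min_rho H s ts t)\<^sup>2 \<le> resid_var ts t"
      by (rule resid_var_ge[OF _ im ae]) simp
  qed (use C3 in simp)
qed

lemma prod_list_indicator_mult:
  "(\<Prod>t\<leftarrow>ts. indicator (B t) \<omega> * c) = indicator {\<omega>. \<forall>t\<in>set ts. \<omega> \<in> B t} \<omega> * (c::ennreal) ^ length ts"
  by (induction ts) (auto simp: indicator_def mult_ac)

text \<open>This is \<open>nn_integral_power_le\<close> started at the empty list, with
  \<open>f t\<close> the normalized indicator of a cube at \<open>Z t\<close>. \<open>C\<close> does
  not depend on \<open>e\<close>, as the factors \<open>2 * e\<close> of the small ball bound cancel
  the normalization. Joint measurability of \<open>Z\<close> allows the exchange of
  integrals.\<close>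

lemma occupation_moment_bound:
  fixes X :: "real ^ 'n \<Rightarrow> 'w \<Rightarrow> real ^ 'd" and Y :: "real ^ 'n \<Rightarrow> 'u \<Rightarrow> real"
  assumes "prob_space M" "prob_space P"
    and X: "gaussian_field M X" "mean_zero M X" and Y: "gaussian_field P Y" and iid: "iid_copies M X P Y"
    and A: "condition_A P Y T H" and d: "real CARD('d) < hdim H" and s: "s \<in> T" and T: "bounded T"
    and Z: "case_prod Z \<in> borel_measurable (borel \<Otimes>\<^sub>M M)" "AE \<omega> in M. \<forall>t. Z t \<omega> = X t \<omega>"
  shows "\<exists>C>0. \<forall>S x e n. S \<in> sets borel \<and> S \<subseteq> T \<and> 0 < e \<and> 1 \<le> n \<longrightarrow>
    (\<integral>\<^sup>+\<omega>. (\<integral>\<^sup>+t. indicator S t * indicator (cbox (\<chi> j. x $ j - e) (\<chi> j. x $ j + e)) (Z t \<omega>) *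
        ennreal (1 / (2 * e) ^ CARD('d)) \<partial>lborel) ^ n \<partial>M)
    \<le> ennreal (C ^ n * fact n powr (real CARD('d) / hdim H) *
        measure lborel S powr (real n * (1 - real CARD('d) / hdim H)))"
proof -
  interpret M: prob_space M by fact
  interpret P: prob_space P by fact
  have Xm [measurable]: "\<And>t. X t \<in> borel_measurable M" using X by (auto simp: gaussian_field_def)
  have Ym [measurable]: "\<And>t. Y t \<in> borel_measurable P" using Y by (auto simp: gaussian_field_def)
  interpret G: centered_gaussian_field P Y
    by unfold_locales (use Y iid_copies_mean_zero[OF iid Xm Ym X(2)] in auto)
  have H: "\<And>j. 0 < H $ j" using A by (auto simp: condition_A_def)
  obtain c where c: "0 < c" and cv: "\<And>ts t. set ts \<subseteq> T \<Longrightarrow> t \<in> T \<Longrightarrow>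
      (c * min_rho H s ts t)\<^sup>2 \<le> G.resid_var ts t"
    using condition_A_resid_var[OF G.centered_gaussian_field_axioms A s] by blast
  define dd where "dd = CARD('d)"
  have dd: "0 < dd" by (simp add: dd_def)
  define q where "q = real dd / hdim H"
  have q: "0 \<le> q" "q \<le> 1" using d unfolding q_def dd_def by auto
  \<comment> \<open>\<open>v ts t\<close> stands for a bound on the conditional density of
    \<open>X t\<close> given its values on \<open>ts\<close>: each of the \<open>dd\<close>
    coordinates contributes an inverse conditional standard deviation, at most
    \<open>1 / (c * min_rho H s ts t)\<close>.\<close>
  define v where "v ts t = ennreal (1 / c) ^ dd * inverse (ennreal (min_rho H s ts t)) ^ dd" for ts t
  define w where "w ts = (\<Prod>k<length ts. v (drop (Suc k) ts) (ts ! k))" for ts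
  define K where "K = (1 + 2 ^ dd * 2 ^ CARD('n) / (1 - 2 powr (real dd - hdim H)))"
  have K: "0 < K"
    unfolding K_def using d powr_less_mono[of "real dd - hdim H" 0 2] by (auto simp: dd_def intro!: add_pos_nonneg)
  \<comment> \<open>The factor 2 comes from \<open>prod_powr_le_fact\<close>, \<open>1 / c\<close>
    from the residual variances, and \<open>K\<close> from
    \<open>nn_integral_min_rho\<close>.\<close>
  define C where "C = 2 * ((1 / c) ^ dd * K)"
  have C: "0 < C" using c K by (simp add: C_def)
  have bound: "(\<integral>\<^sup>+\<omega>. (\<integral>\<^sup>+t. indicator S t * indicator (cbox (\<chi> j. x $ j - e) (\<chi> j. x $ j + e)) (Z t \<omega>) *
        ennreal (1 / (2 * e) ^ dd) \<partial>lborel) ^ n \<partial>M)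
    \<le> ennreal (C ^ n * fact n powr q * measure lborel S powr (real n * (1 - q)))"
    if S: "S \<in> sets borel" "S \<subseteq> T" and e: "0 < e" and n: "1 \<le> n" for S x e n
  proof -
    define Q where "Q = cbox (\<chi> j. x $ j - e) (\<chi> j. x $ j + e)"
    define f where "f t \<omega> = indicator S t * indicator Q (Z t \<omega>) * ennreal (1 / (2 * e) ^ dd)" for t \<omega>
    note [measurable] = S(1) Z(1)
    have [measurable]: "Q \<in> sets borel" by (simp add: Q_def)
    have Zt [measurable]: "Z t \<in> borel_measurable M" for t
      using measurable_compose[OF measurable_Pair1' Z(1), of t] by simp
    define l where "l = measure lborel S"
    have "emeasure lborel S < \<infinity>"
      using emeasure_bounded_finite[OF bounded_subset[OF T S(2)]] .
    then have l: "emeasure lborel S = ennreal l" "0 \<le> l"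
      by (auto simp: l_def emeasure_eq_ennreal_measure)
    define b where "b k = ennreal ((1 / c) ^ dd * K * (real (k + 2) powr q * l powr (1 - q)))" for k :: nat
    have step: "(\<integral>\<^sup>+\<omega>. (\<Prod>t\<leftarrow>[]. f t \<omega>) * (\<integral>\<^sup>+t. f t \<omega> \<partial>lborel) ^ n \<partial>M)
      \<le> w [] * (\<Prod>i<n. b (length ([]::(real^'n) list) + i))"
    proof (rule nn_integral_power_le[where A = S and v = v])
      show "case_prod f \<in> borel_measurable (lborel \<Otimes>\<^sub>M M)"
        unfolding f_def split_beta' by measurable
      show "f t \<omega> = 0" if "t \<notin> S" for t \<omega> using that by (simp add: f_def)
      show "w (t # ts) = w ts * v ts t" for t ts
        by (simp add: w_def prod.lessThan_Suc_shift mult.commute del: prod.lessThan_Suc)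
      show "v ts \<in> borel_measurable lborel" for ts
        unfolding v_def by measurable
      show "(\<integral>\<^sup>+t. v ts t * indicator S t \<partial>lborel) \<le> b (length ts)" for ts
      proof -
        have "(\<integral>\<^sup>+t. v ts t * indicator S t \<partial>lborel)
          = ennreal (1 / c) ^ dd * (\<integral>\<^sup>+t. inverse (ennreal (min_rho H s ts t)) ^ dd * indicator S t \<partial>lborel)"
          unfolding v_def by (subst nn_integral_cmult[symmetric]) (auto simp: mult.assoc)
        also have "\<dots> \<le> ennreal (1 / c) ^ dd * ennreal (K * (real (length ts + 2) powr q * l powr (1 - q)))"
        proof (rule mult_left_mono)
          show "(\<integral>\<^sup>+t. inverse (ennreal (min_rho H s ts t)) ^ dd * indicator S t \<partial>lborel)
            \<le> ennreal (K * (real (length ts + 2) powr q * l powr (1 - q)))"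
            unfolding min_rho_def K_def q_def
            by (rule nn_integral_min_rho[OF H _ _ _ _ S(1) l])
              (use d card_length[of "0 # s # ts"] in \<open>auto simp: dd_def\<close>)
        qed simp
        also have "\<dots> = b (length ts)"
          using c K by (simp add: b_def ennreal_power ennreal_mult mult.assoc)
        finally show ?thesis .
      qed
      show "(\<integral>\<^sup>+\<omega>. (\<Prod>t\<leftarrow>ts. f t \<omega>) \<partial>M) \<le> w ts" if ts: "set ts \<subseteq> S" for ts
      proof (cases "\<exists>k<length ts. min_rho H s (drop (Suc k) ts) (ts ! k) = 0")
        \<comment> \<open>A point equal to the origin, to \<open>s\<close> or to one already
          conditioned on makes its weight infinite; no factor of \<open>w ts\<close> is
          \<open>0\<close>, so the whole product is \<open>top\<close>.\<close>
        case True
        then obtain k where k: "k < length ts" "min_rho H s (drop (Suc k) ts) (ts ! k) = 0" by auto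
        have "v us u \<noteq> 0" for us u
          using c by (auto simp: v_def ennreal_power[symmetric])
        moreover have "v (drop (Suc k) ts) (ts ! k) = top"
          using k c dd by (simp add: v_def ennreal_mult_eq_top_iff power_eq_top_ennreal)
        ultimately have "w ts = top"
          unfolding w_def using k by (subst ennreal_prod_eq_top) auto
        then show ?thesis by simp
      next
        case False
        let ?E = "{\<omega> \<in> space M. \<forall>t\<in>set ts. \<forall>j. \<bar>X t \<omega> $ j - x $ j\<bar> \<le> e}"
        define r where "r k = min_rho H s (drop (Suc k) ts) (ts ! k)" for k
        have r: "0 < r k" if "k < length ts" for k
          using False that min_rho_nonneg[of H s "drop (Suc k) ts" "ts ! k"] by (auto simp: r_def less_le)
        have pts: "ts ! k \<in> T" "set (drop (Suc k) ts) \<subseteq> T" if "k < length ts" for k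
          using subset_trans[OF ts S(2)] nth_mem[OF that] set_drop_subset[of "Suc k" ts] by blast+
        have rv: "(c * r k)\<^sup>2 \<le> G.resid_var (drop (Suc k) ts) (ts ! k)" if "k < length ts" for k
          unfolding r_def by (rule cv) (use pts[OF that] in auto)
        have pos: "0 < G.resid_var vs t" if "ts = us @ t # vs" for us t vs
        proof -
          have "length us < length ts" "ts ! length us = t" "drop (Suc (length us)) ts = vs"
            using that by auto
          then show ?thesis using rv[of "length us"] r[of "length us"] c
            by (auto intro: less_le_trans[of 0 "(c * r (length us))\<^sup>2"])
        qed
        have P: "measure P {\<omega> \<in> space P. \<forall>t\<in>set ts. \<bar>Y t \<omega> - y\<bar> \<le> e}
          \<le> (\<Prod>k<length ts. 2 * e * (1 / c * inverse (r k)))" for y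
        proof (rule order_trans[OF G.prob_small_ball_le[OF e pos]], assumption, rule prod_mono, intro conjI)
          fix k assume "k \<in> {..<length ts}"
          then have k: "k < length ts" by simp
          have le: "c * r k \<le> sqrt (G.resid_var (drop (Suc k) ts) (ts ! k))"
            using rv[OF k] by (rule real_le_rsqrt)
          have cr: "0 < c * r k" using c r[OF k] by simp
          have "2 * e / sqrt (G.resid_var (drop (Suc k) ts) (ts ! k)) \<le> 2 * e / (c * r k)"
            by (rule divide_left_mono[OF le _ mult_pos_pos[OF less_le_trans[OF cr le] cr]]) (use e in simp)
          then show "2 * e / sqrt (G.resid_var (drop (Suc k) ts) (ts ! k)) \<le> 2 * e * (1 / c * inverse (r k))"
            by (simp add: field_simps)
        qed (use e in \<open>auto simp: G.resid_var_def G.ip_nonneg\<close>)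
        have ME: "measure M ?E \<le> (\<Prod>k<length ts. 2 * e * (1 / c * inverse (r k))) ^ dd"
          unfolding iid_copies_prob_cube[OF \<open>prob_space M\<close> iid Xm Ym] dd_def prod_constant[symmetric]
          by (intro prod_mono conjI P) auto
        have "(\<integral>\<^sup>+\<omega>. (\<Prod>t\<leftarrow>ts. f t \<omega>) \<partial>M) = (\<integral>\<^sup>+\<omega>. ennreal ((1 / (2 * e) ^ dd) ^ length ts) * indicator ?E \<omega> \<partial>M)"
        proof (rule nn_integral_cong_AE, use Z(2) AE_space in eventually_elim)
          case (elim \<omega>)
          have "map (\<lambda>t. f t \<omega>) ts = map (\<lambda>t. indicator {\<omega>. Z t \<omega> \<in> Q} \<omega> * ennreal (1 / (2 * e) ^ dd)) ts"
            using ts by (auto simp: f_def indicator_def)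
          then have "(\<Prod>t\<leftarrow>ts. f t \<omega>) = indicator {\<omega>. \<forall>t\<in>set ts. Z t \<omega> \<in> Q} \<omega> * ennreal (1 / (2 * e) ^ dd) ^ length ts"
            by (simp only: prod_list_indicator_mult) simp
          also have "indicator {\<omega>. \<forall>t\<in>set ts. Z t \<omega> \<in> Q} \<omega> = (indicator ?E \<omega> :: ennreal)"
            using elim by (auto simp: indicator_def Q_def mem_cube)
          finally show ?case using e by (simp add: ennreal_power mult.commute)
        qed
        also have "\<dots> = ennreal ((1 / (2 * e) ^ dd) ^ length ts) * emeasure M ?E"
          by (rule nn_integral_cmult_indicator) measurable
        also have "\<dots> = ennreal ((1 / (2 * e) ^ dd) ^ length ts * measure M ?E)"
          using e by (simp add: M.emeasure_eq_measure ennreal_mult)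
        also have "\<dots> \<le> ennreal ((1 / (2 * e) ^ dd) ^ length ts * (\<Prod>k<length ts. 2 * e * (1 / c * inverse (r k))) ^ dd)"
          using ME e by (intro ennreal_leI mult_left_mono) auto
        also have "(1 / (2 * e) ^ dd) ^ length ts * (\<Prod>k<length ts. 2 * e * (1 / c * inverse (r k))) ^ dd
          = (\<Prod>k<length ts. (1 / c) ^ dd * inverse (r k) ^ dd)"
        proof -
          have "a ^ m * (\<Prod>k<m. g k) ^ dd = (\<Prod>k<m. a * g k ^ dd)" for a :: real and m g
            by (simp add: prod.distrib prod_power_distrib)
          then have "(1 / (2 * e) ^ dd) ^ length ts * (\<Prod>k<length ts. 2 * e * (1 / c * inverse (r k))) ^ dd
            = (\<Prod>k<length ts. 1 / (2 * e) ^ dd * (2 * e * (1 / c * inverse (r k))) ^ dd)"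
            .
          also have "\<dots> = (\<Prod>k<length ts. (1 / c) ^ dd * inverse (r k) ^ dd)"
          proof (intro prod.cong refl)
            fix k
            have "1 / a ^ dd * (a * y) ^ dd = y ^ dd" if "0 < a" for a y :: real
              using that by (simp add: power_mult_distrib)
            from this[of "2 * e" "1 / c * inverse (r k)"] e
            show "1 / (2 * e) ^ dd * (2 * e * (1 / c * inverse (r k))) ^ dd = (1 / c) ^ dd * inverse (r k) ^ dd"
              by (simp only: power_mult_distrib[symmetric] mult_pos_pos zero_less_numeral)
          qed
          finally show ?thesis .
        qed
        also have "ennreal (\<Prod>k<length ts. (1 / c) ^ dd * inverse (r k) ^ dd) = (\<Prod>k<length ts. ennreal ((1 / c) ^ dd * inverse (r k) ^ dd))"
          using c r by (intro prod_ennreal[symmetric]) (auto intro!: mult_nonneg_nonneg less_imp_le)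
        also have "\<dots> = w ts"
          unfolding w_def v_def
        proof (intro prod.cong refl)
          fix k assume "k \<in> {..<length ts}"
          then have rk: "0 < r k" using r by simp
          have "ennreal ((1 / c) ^ dd * inverse (r k) ^ dd) = ennreal ((1 / c) ^ dd) * ennreal (inverse (r k) ^ dd)"
            by (rule ennreal_mult) (use c rk in auto)
          then show "ennreal ((1 / c) ^ dd * inverse (r k) ^ dd)
            = ennreal (1 / c) ^ dd * inverse (ennreal (min_rho H s (drop (Suc k) ts) (ts ! k))) ^ dd"
            using c rk unfolding r_def by (simp only: ennreal_power inverse_ennreal inverse_nonnegative_iff_nonnegative
              zero_le_divide_1_iff less_imp_le)
        qed
        finally show ?thesis .
      qed
    qed (use S M.sigma_finite_measure_axioms in \<open>auto intro: sigma_finite_lborel\<close>)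
    also have "w [] * (\<Prod>i<n. b (length ([]::(real^'n) list) + i)) = ennreal (\<Prod>i<n. (1 / c) ^ dd * K * (real (i + 2) powr q * l powr (1 - q)))"
      unfolding w_def b_def using c K by (simp add: prod_ennreal)
    also have "\<dots> \<le> ennreal (C ^ n * fact n powr q * l powr (n * (1 - q)))"
      unfolding C_def using c K l q n by (intro ennreal_leI prod_powr_le_fact) auto
    finally show ?thesis by (simp add: f_def Q_def l_def)
  qed
  show ?thesis
    by (rule exI[of _ C]) (use C bound in \<open>auto simp: dd_def q_def\<close>)
qed

section \<open>Moments of local times\<close>

text \<open>Coordinates are matched to \<open>x\<close> one at a time: a point that mixes
  coordinates of two points of an interval lies between them, hence in the interval.\<close>

lemma is_interval_cart_product:
  fixes S :: "(real ^ 'n) set"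
  assumes S: "is_interval S" "S \<noteq> {}" and x: "\<And>j. x $ j \<in> (\<lambda>t. t $ j) ` S"
  shows "x \<in> S"
proof -
  have "\<exists>s\<in>S. \<forall>j\<in>K. s $ j = x $ j" for K :: "'n set"
    using finite[of K]
  proof (induction K)
    case empty
    then show ?case using S(2) by auto
  next
    case (insert k K)
    obtain s where s: "s \<in> S" "\<forall>j\<in>K. s $ j = x $ j" using insert by auto
    obtain s' where s': "s' \<in> S" "s' $ k = x $ k" using x[of k] by auto
    define z where "z = (\<chi> j. if j = k then x $ k else s $ j)"
    have "z \<in> S"
    proof -
      have "s $ j \<le> z $ j \<and> z $ j \<le> s' $ j \<or> s' $ j \<le> z $ j \<and> z $ j \<le> s $ j" for j
        using s'(2) by (auto simp: z_def)
      then show ?thesis using S(1) s(1) s'(1) unfolding is_interval_cart by blast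
    qed
    then show ?case using s(2) insert.hyps by (intro bexI[of _ z]) (auto simp: z_def)
  qed
  from this[of UNIV] show ?thesis by (metis UNIV_I vec_eq_iff)
qed

lemma borel_real_between:
  fixes J :: "real set"
  assumes "{a<..<b} \<subseteq> J" "J \<subseteq> {a..b}"
  shows "J \<in> sets borel"
proof -
  have "J = {a<..<b} \<union> (J \<inter> {a, b})" using assms by (auto simp: less_le)
  moreover have "J \<inter> {a, b} \<in> sets borel" by (intro borel_closed finite_imp_closed) auto
  ultimately show ?thesis by (metis borel_open open_greaterThanLessThan sets.Un)
qed

lemma fmeasurable_cbox: "cbox a b \<in> fmeasurable lborel"
  by (rule fmeasurableI[OF _ emeasure_lborel_cbox_finite]) simp

text \<open>Infima and suprema of the coordinate projections give the corners. The interval lies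
  between the open and the closed box, which have the same volume, and is Borel because it is the
  product of Borel projections.\<close>

lemma bounded_interval_cbox:
  fixes S :: "(real ^ 'n) set"
  assumes S: "is_interval S" "S \<noteq> {}" "S \<subseteq> cbox c d"
  obtains a b where "a \<in> cbox c d" "b \<in> cbox c d" "\<forall>j. a $ j \<le> b $ j" "S \<subseteq> cbox a b" "S \<in> sets borel"
    "measure lborel S = (\<Prod>j\<in>UNIV. b $ j - a $ j)"
proof -
  define J where "J j = (\<lambda>t. t $ j) ` S" for j
  define a b where "a = (\<chi> j. Inf (J j))" and "b = (\<chi> j. Sup (J j))"
  have ne: "J j \<noteq> {}" for j using S(2) by (auto simp: J_def)
  have cd: "J j \<subseteq> {c $ j..d $ j}" for j
    using S(3) by (auto simp: J_def mem_box_cart)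
  then have bd: "bdd_below (J j)" "bdd_above (J j)" for j
    by (meson bdd_below_mono bdd_below_Icc) (meson bdd_above_mono bdd_above_Icc cd)
  have ab: "J j \<subseteq> {a $ j..b $ j}" for j
    using bd[of j] by (auto simp: a_def b_def intro: cInf_lower cSup_upper)
  have acd: "c $ j \<le> a $ j" "b $ j \<le> d $ j" for j
    using ne[of j] cd[of j] by (auto simp: a_def b_def intro!: cInf_greatest cSup_least)
  have le: "a $ j \<le> b $ j" for j using ne[of j] ab[of j] by fastforce
  have int: "{a $ j<..<b $ j} \<subseteq> J j" for j
  proof
    fix y assume "y \<in> {a $ j<..<b $ j}"
    then have "Inf (J j) < y" "y < Sup (J j)" by (auto simp: a_def b_def)
    then obtain u v where uv: "u \<in> J j" "u < y" "v \<in> J j" "y < v"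
      using cInf_lessD[OF ne] less_cSupD[OF ne] by metis
    then obtain s t where st: "s \<in> S" "t \<in> S" "u = s $ j" "v = t $ j" by (auto simp: J_def)
    define z where "z = (\<chi> i. if i = j then y else s $ i)"
    have "s $ i \<le> z $ i \<and> z $ i \<le> t $ i \<or> t $ i \<le> z $ i \<and> z $ i \<le> s $ i" for i
      using uv st by (auto simp: z_def)
    then have "z \<in> S" using S(1) st(1,2) unfolding is_interval_cart by blast
    then show "y \<in> J j" unfolding J_def by (intro image_eqI[of _ _ z]) (auto simp: z_def)
  qed
  have "x \<in> S" if "\<forall>j. x $ j \<in> J j" for x
    using that unfolding J_def by (intro is_interval_cart_product[OF S(1,2)]) blast
  moreover have memJ: "x $ j \<in> J j" if "x \<in> S" for x j
    using that by (auto simp: J_def)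
  ultimately have eq: "S = {x \<in> space borel. \<forall>j. x $ j \<in> J j}" by auto
  have [measurable]: "J j \<in> sets borel" for j
    by (rule borel_real_between[OF int ab])
  have Sb: "S \<in> sets borel"
    by (subst eq) measurable
  have sub: "box a b \<subseteq> S" "S \<subseteq> cbox a b"
  proof -
    show "box a b \<subseteq> S"
      using subsetD[OF int] by (subst eq) (simp add: mem_box_cart subset_iff)
    have "a $ j \<le> x $ j \<and> x $ j \<le> b $ j" if "x \<in> S" for x j
      using subsetD[OF ab memJ[OF that, of j]] by simp
    then show "S \<subseteq> cbox a b" by (auto simp: mem_box_cart)
  qed
  have "measure lborel (box a b) \<le> measure lborel S"
    by (rule measure_mono_fmeasurable[OF sub(1)]) (use Sb emeasure_bounded_finite[OF bounded_subset[OF bounded_cbox sub(2)]] in \<open>auto simp: fmeasurable_def\<close>)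
  moreover have "measure lborel S \<le> measure lborel (cbox a b)"
    by (rule measure_mono_fmeasurable[OF sub(2)]) (use Sb fmeasurable_cbox in auto)
  moreover have "measure lborel (cbox a b) = (\<Prod>j\<in>UNIV. b $ j - a $ j)"
    by (rule content_cbox_cart) (use le in \<open>simp add: interval_ne_empty_cart(1)\<close>)
  moreover have "measure lborel (box a b) = measure lborel (cbox a b)"
    by (simp only: measure_lborel_box_eq measure_lborel_cbox_eq)
  ultimately have "measure lborel S = (\<Prod>j\<in>UNIV. b $ j - a $ j)"
    by simp
  then show thesis
    using that[of a b] acd le sub(2) Sb by (auto simp: mem_box_cart intro: order_trans)
qed

section \<open>Passage from cubes to the local time at a point\<close>

text \<open>Fatou's lemma along cubes of half side \<open>1 / Suc k\<close>, applied to the pathwise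
  bound \<open>local_time_power_le_liminf\<close>. The occupation integrals are formed with
  \<open>Z\<close>, which makes them measurable in \<open>\<omega>\<close>.\<close>

lemma local_time_moment_halfopen:
  fixes X :: "real ^ 'n \<Rightarrow> 'w \<Rightarrow> real ^ 'd" and L :: "'w \<Rightarrow> real ^ 'd \<Rightarrow> (real ^ 'n) measure"
  assumes cont: "continuous_field M X"
    and Z: "case_prod Z \<in> borel_measurable (borel \<Otimes>\<^sub>M M)" "AE \<omega> in M. \<forall>t. Z t \<omega> = X t \<omega>"
    and T: "T \<in> sets borel" "T \<subseteq> cbox \<tau> (\<tau> + h)"
    and L: "jointly_continuous_local_time M X T \<tau> h L" and b: "b \<in> cbox \<tau> (\<tau> + h)"
    and bound: "\<And>e. 0 < e \<Longrightarrow> (\<integral>\<^sup>+\<omega>. (\<integral>\<^sup>+t. indicator (halfopen T UNIV a b) t *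
        indicator (cbox (\<chi> j. x $ j - e) (\<chi> j. x $ j + e)) (Z t \<omega>) *
        ennreal (1 / (2 * e) ^ CARD('d)) \<partial>lborel) ^ n \<partial>M) \<le> B"
  shows "(\<integral>\<^sup>+\<omega>. emeasure (L \<omega> x) (halfopen T UNIV a b) ^ n \<partial>M) \<le> B"
proof -
  define S where "S = halfopen T UNIV a b"
  have S [measurable]: "S \<in> sets borel" unfolding S_def by (rule halfopen_borel[OF T(1)])
  have ST: "S \<subseteq> T" by (auto simp: S_def halfopen_def)
  define e where "e k = 1 / real (Suc k)" for k
  have e: "0 < e k" "e \<longlonglongrightarrow> 0" for k
    using LIMSEQ_inverse_real_of_nat by (auto simp: e_def[abs_def] inverse_eq_divide)
  define Q where "Q k = cbox (\<chi> j. x $ j - e k) (\<chi> j. x $ j + e k)" for k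
  have [measurable]: "Q k \<in> sets borel" for k by (simp add: Q_def)
  define A where "A k \<omega> = (\<integral>\<^sup>+t. indicator S t * indicator (Q k) (Z t \<omega>) *
    ennreal (1 / (2 * e k) ^ CARD('d)) \<partial>lborel)" for k \<omega>
  have "(\<lambda>p. Z (snd p) (fst p)) \<in> borel_measurable (M \<Otimes>\<^sub>M lborel)"
    using measurable_compose[OF measurable_pair_swap' Z(1)] by (simp add: split_beta')
  then have [measurable]: "A k \<in> borel_measurable M" for k
    unfolding A_def by measurable
  have ver: "AE \<omega> in M. local_time_version (\<lambda>t. X t \<omega>) S (\<lambda>y. emeasure (L \<omega> y) S)"
    and ms: "AE \<omega> in M. \<forall>x. sets (L \<omega> x) = sets borel \<and> finite_measure (L \<omega> x) \<and> emeasure (L \<omega> x) (- T) = 0"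
    and jc: "AE \<omega> in M. continuous_on (UNIV \<times> cbox 0 h) (\<lambda>(x, s). measure (L \<omega> x) (T \<inter> cbox \<tau> (\<tau> + s)))"
    using L S ST unfolding jointly_continuous_local_time_def by auto
  have "AE \<omega> in M. emeasure (L \<omega> x) S ^ n \<le> liminf (\<lambda>k. A k \<omega> ^ n)"
    using cont[unfolded continuous_field_def] Z(2) ver ms jc
  proof eventually_elim
    case (elim \<omega>)
    have "continuous_on UNIV (\<lambda>y. measure (L \<omega> y) (T \<inter> cbox \<tau> (\<tau> + s)))" if "s \<in> cbox 0 h" for s
    proof -
      have "continuous_on UNIV (\<lambda>y. (y, s))" by (intro continuous_intros)
      from continuous_on_compose2[OF elim(5) this] that show ?thesis by auto
    qed
    then have c: "continuous_on UNIV (\<lambda>y. measure (L \<omega> y) S)"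
      unfolding S_def using elim(4) T b by (intro continuous_on_measure_halfopen) auto
    have "emeasure (L \<omega> x) S ^ n \<le> liminf (\<lambda>k. (\<integral>\<^sup>+t. indicator S t *
       indicator (cbox (\<chi> j. x $ j - e k) (\<chi> j. x $ j + e k)) (X t \<omega>) * ennreal (1 / (2 * e k) ^ CARD('d)) \<partial>lborel) ^ n)"
      by (rule local_time_power_le_liminf[OF elim(1) S elim(3) _ c e]) (use elim(4) in auto)
    then show ?case using elim(2) by (simp add: A_def Q_def)
  qed
  then have "(\<integral>\<^sup>+\<omega>. emeasure (L \<omega> x) S ^ n \<partial>M) \<le> (\<integral>\<^sup>+\<omega>. liminf (\<lambda>k. A k \<omega> ^ n) \<partial>M)"
    by (rule nn_integral_mono_AE)
  also have "\<dots> \<le> liminf (\<lambda>k. \<integral>\<^sup>+\<omega>. A k \<omega> ^ n \<partial>M)"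
    by (rule nn_integral_liminf) measurable
  also have "\<dots> \<le> B"
  proof -
    have "(\<integral>\<^sup>+\<omega>. A k \<omega> ^ n \<partial>M) \<le> B" for k
      using bound[OF e(1)[of k]] by (simp add: A_def S_def Q_def)
    then have "liminf (\<lambda>k. \<integral>\<^sup>+\<omega>. A k \<omega> ^ n \<partial>M) \<le> liminf (\<lambda>k. B)"
      by (intro Liminf_mono always_eventually) auto
    then show ?thesis by (simp add: Liminf_const)
  qed
  finally show ?thesis by (simp add: S_def)
qed

theorem proposition2p4:
  fixes M :: "'w measure" and P :: "'u measure"
    and X :: "real ^ 'n \<Rightarrow> 'w \<Rightarrow> real ^ 'd" and Y :: "real ^ 'n \<Rightarrow> 'u \<Rightarrow> real"
    and T :: "(real ^ 'n) set" and \<tau> h H :: "real ^ 'n"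
    and L :: "'w \<Rightarrow> real ^ 'd \<Rightarrow> (real ^ 'n) measure"
  assumes "prob_space M" and "prob_space P"
    and "gaussian_field M X" and "mean_zero M X" and "continuous_field M X"
    and "gaussian_field P Y" and "iid_copies M X P Y"
    and "\<forall>j. 0 < h $ j"
    and "T = cbox \<tau> (\<tau> + h) \<or> T = box \<tau> (\<tau> + h)"
    and "condition_A P Y T H"
    and "real CARD('d) < hdim H"
    and "jointly_continuous_local_time M X T \<tau> h L"
  shows "\<exists>C::real. 0 < C \<and>
    (\<forall>S x n. is_interval S \<and> S \<subseteq> T \<and> n \<ge> 1 \<longrightarrow>
       (\<integral>\<^sup>+\<omega>. emeasure (L \<omega> x) S ^ n \<partial>M) \<le>
       ennreal (C ^ n * fact n powr (real CARD('d) / hdim H) *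
                measure lborel S powr (real n * (1 - real CARD('d) / hdim H)))) \<and>
    (\<forall>a r x n. a \<in> T \<and> 0 < r \<and> r < 1 \<and> rho_ball H a r \<subseteq> T \<and> n \<ge> 1 \<longrightarrow>
       (\<integral>\<^sup>+\<omega>. emeasure (L \<omega> x) (rho_ball H a r) ^ n \<partial>M) \<le>
       ennreal (C ^ n * fact n powr (real CARD('d) / hdim H) *
                r powr (real n * (hdim H - real CARD('d)))))"
proof -
  define q where "q = real CARD('d) / hdim H"
  have Q: "0 < hdim H" using assms(11) by (meson of_nat_0_le_iff le_less_trans)
  have q: "0 < 1 - q" using assms(11) Q by (simp add: q_def)
  have H: "0 < H $ j" for j using assms(10) by (auto simp: condition_A_def)
  have T: "T \<in> sets borel" "T \<subseteq> cbox \<tau> (\<tau> + h)" "bounded T" "is_interval T"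
    using assms(9) box_subset_cbox by (auto simp: bounded_box is_interval_cbox is_interval_box)
  \<comment> \<open>The centre of \<open>T\<close> serves as the fixed point \<open>s\<close> of
    \<open>occupation_moment_bound\<close>; it lies in \<open>T\<close> whether \<open>T\<close> is
    closed or open.\<close>
  have mid: "(\<chi> j. \<tau> $ j + h $ j / 2) \<in> T"
    using assms(8,9) by (auto simp: mem_box_cart) (smt (verit) field_sum_of_halves)+
  have Xm: "X t \<in> borel_measurable M" for t using assms(3) by (auto simp: gaussian_field_def)
  obtain Z where Z: "case_prod Z \<in> borel_measurable (borel \<Otimes>\<^sub>M M)" "AE \<omega> in M. \<forall>t. Z t \<omega> = X t \<omega>"
    using continuous_field_measurable_modification[OF Xm assms(5)] by blast
  from occupation_moment_bound[OF assms(1-4,6,7,10,11) mid T(3) Z]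
  obtain C where C: "0 < C" and "\<forall>S x e n. S \<in> sets borel \<and> S \<subseteq> T \<and> 0 < e \<and> 1 \<le> n \<longrightarrow>
    (\<integral>\<^sup>+\<omega>. (\<integral>\<^sup>+t. indicator S t * indicator (cbox (\<chi> j. x $ j - e) (\<chi> j. x $ j + e)) (Z t \<omega>) *
        ennreal (1 / (2 * e) ^ CARD('d)) \<partial>lborel) ^ n \<partial>M)
    \<le> ennreal (C ^ n * fact n powr q * measure lborel S powr (real n * (1 - q)))"
    unfolding q_def[symmetric] by (elim exE conjE) (rule that)
  then have occ: "(\<integral>\<^sup>+\<omega>. (\<integral>\<^sup>+t. indicator S t * indicator (cbox (\<chi> j. x $ j - e) (\<chi> j. x $ j + e)) (Z t \<omega>) *
        ennreal (1 / (2 * e) ^ CARD('d)) \<partial>lborel) ^ n \<partial>M)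
    \<le> ennreal (C ^ n * fact n powr q * measure lborel S powr (real n * (1 - q)))"
    if "S \<in> sets borel" "S \<subseteq> T" "0 < e" "1 \<le> n" for S x e n
    using that by simp
  have "AE \<omega> in M. \<forall>x. sets (L \<omega> x) = sets borel \<and> finite_measure (L \<omega> x) \<and> emeasure (L \<omega> x) (- T) = 0"
    using assms(12) unfolding jointly_continuous_local_time_def by (elim conjE)
  then have ms: "AE \<omega> in M. \<forall>x. sets (L \<omega> x) = sets borel"
    by eventually_elim simp
  have mono: "(\<integral>\<^sup>+\<omega>. emeasure (L \<omega> x) A ^ n \<partial>M) \<le> (\<integral>\<^sup>+\<omega>. emeasure (L \<omega> x) B ^ n \<partial>M)"
    if "A \<subseteq> B" "B \<in> sets borel" for A B x n
  proof (rule nn_integral_mono_AE, use ms in eventually_elim)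
    case (elim \<omega>)
    then show ?case using that by (intro power_mono emeasure_mono) auto
  qed
  have int: "(\<integral>\<^sup>+\<omega>. emeasure (L \<omega> x) S ^ n \<partial>M)
      \<le> ennreal (C ^ n * fact n powr q * measure lborel S powr (real n * (1 - q)))"
    if S: "is_interval S" "S \<subseteq> T" and n: "1 \<le> n" for S x n
  proof (cases "S = {}")
    case True
    then show ?thesis using n by (simp add: power_0_left)
  next
    case False
    obtain a b where ab: "a \<in> cbox \<tau> (\<tau> + h)" "b \<in> cbox \<tau> (\<tau> + h)" "\<forall>j. a $ j \<le> b $ j" "S \<subseteq> cbox a b"
      "S \<in> sets borel" "measure lborel S = (\<Prod>j\<in>UNIV. b $ j - a $ j)"
      by (rule bounded_interval_cbox[OF S(1) False subset_trans[OF S(2) T(2)]])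
    define p where "p = real n * (1 - q)"
    have p: "0 < p" using n q by (simp add: p_def)
    \<comment> \<open>The half-open boxes miss their lower faces, so \<open>a\<close> is lowered by
      \<open>\<delta> k\<close> to enclose \<open>S\<close>; letting \<open>\<delta> k\<close> tend
      to zero recovers the volume of \<open>S\<close>.\<close>
    define \<delta> where "\<delta> k = 1 / real (Suc k)" for k
    have \<delta>: "0 < \<delta> k" "\<delta> \<longlonglongrightarrow> 0" for k
      using LIMSEQ_inverse_real_of_nat by (auto simp: \<delta>_def[abs_def] inverse_eq_divide)
    define V where "V k = (\<Prod>j\<in>UNIV. b $ j - a $ j + \<delta> k)" for k
    have step: "(\<integral>\<^sup>+\<omega>. emeasure (L \<omega> x) S ^ n \<partial>M) \<le> ennreal (C ^ n * fact n powr q * V k powr p)" for k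
    proof -
      define a' where "a' = (\<chi> j. a $ j - \<delta> k)"
      define S' where "S' = halfopen T UNIV a' b"
      have S'b: "S' \<in> sets borel" unfolding S'_def by (rule halfopen_borel[OF T(1)])
      have "S \<subseteq> S'"
      proof
        fix t assume t: "t \<in> S"
        then have "a $ j \<le> t $ j" and "t $ j \<le> b $ j" for j using ab(4) by (auto simp: mem_box_cart)
        moreover have "a' $ j < t $ j" for j
          using \<delta>(1)[of k] \<open>\<And>j. a $ j \<le> t $ j\<close>[of j] by (simp add: a'_def)
        ultimately show "t \<in> S'" using t S(2) by (auto simp: S'_def halfopen_def)
      qed
      then have "(\<integral>\<^sup>+\<omega>. emeasure (L \<omega> x) S ^ n \<partial>M) \<le> (\<integral>\<^sup>+\<omega>. emeasure (L \<omega> x) S' ^ n \<partial>M)"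
        by (rule mono[OF _ S'b])
      also have "\<dots> \<le> ennreal (C ^ n * fact n powr q * measure lborel S' powr p)"
        unfolding S'_def p_def
        by (rule local_time_moment_halfopen[OF assms(5) Z T(1,2) assms(12) ab(2)], rule occ[OF halfopen_borel[OF T(1)] _ _ n])
          (auto simp: halfopen_def)
      also have "\<dots> \<le> ennreal (C ^ n * fact n powr q * V k powr p)"
      proof (intro ennreal_leI mult_left_mono powr_mono2)
        have "S' \<subseteq> cbox a' b" by (auto simp: S'_def halfopen_def mem_box_cart less_imp_le)
        then have "measure lborel S' \<le> measure lborel (cbox a' b)"
          using S'b by (intro measure_mono_fmeasurable) (auto intro: fmeasurable_cbox)
        also have "\<dots> = V k"
        proof -
          have "a' $ j \<le> b $ j" for j using spec[OF ab(3), of j] \<delta>(1)[of k] by (simp add: a'_def)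
          then have "cbox a' b \<noteq> {}" by (simp add: interval_ne_empty_cart(1))
          then show ?thesis by (subst content_cbox_cart) (auto simp: V_def a'_def algebra_simps)
        qed
        finally show "measure lborel S' \<le> V k" .
      qed (use p C in auto)
      finally show ?thesis .
    qed
    have "V \<longlonglongrightarrow> (\<Prod>j\<in>UNIV. b $ j - a $ j + 0)"
      unfolding V_def by (intro tendsto_intros \<delta>)
    then have "V \<longlonglongrightarrow> measure lborel S" using ab(6) by simp
    \<comment> \<open>A degenerate interval has volume zero, where continuity of the power rests on
      \<open>0 < p\<close>.\<close>
    then have "(\<lambda>k. V k powr p) \<longlonglongrightarrow> measure lborel S powr p"
    proof (rule tendsto_powr')
      have "0 \<le> V k" for k
        unfolding V_def by (intro prod_nonneg) (use ab(3) less_imp_le[OF \<delta>(1)[of k]] in \<open>auto intro!: add_nonneg_nonneg\<close>)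
      then show "measure lborel S \<noteq> 0 \<or> 0 < p \<and> (\<forall>\<^sub>F k in sequentially. 0 \<le> V k)" using p by auto
    qed simp
    then have "(\<lambda>k. ennreal (C ^ n * fact n powr q * V k powr p)) \<longlonglongrightarrow> ennreal (C ^ n * fact n powr q * measure lborel S powr p)"
      by (intro tendsto_ennrealI tendsto_mult tendsto_const)
    then show ?thesis
      using step unfolding p_def by (intro LIMSEQ_le_const) auto
  qed
  define N where "N = CARD('n)"
  \<comment> \<open>The box around a ball has volume \<open>2 ^ N * r powr hdim H\<close>; the power
    \<open>n * (1 - q)\<close> of \<open>2 ^ N\<close> is absorbed into the constant, which stays at
    least \<open>C\<close> so that it serves both claims.\<close>
  define C' where "C' = C * (2 ^ N) powr (1 - q)"
  have "1 \<le> (2 ^ N :: real) powr (1 - q)" using q by (intro ge_one_powr_ge_zero) auto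
  then have CC': "C \<le> C'" "0 < C'" using C by (auto simp: C'_def)
  show ?thesis
    unfolding q_def[symmetric]
  proof (intro exI[of _ C'] conjI allI impI; (elim conjE)?)
    show "0 < C'" by fact
  next
    fix S x n assume "is_interval S" "S \<subseteq> T" "1 \<le> (n::nat)"
    note int[OF this, of x]
    also have "ennreal (C ^ n * fact n powr q * measure lborel S powr (real n * (1 - q)))
      \<le> ennreal (C' ^ n * fact n powr q * measure lborel S powr (real n * (1 - q)))"
      using CC' C by (intro ennreal_leI mult_right_mono power_mono) auto
    finally show "(\<integral>\<^sup>+\<omega>. emeasure (L \<omega> x) S ^ n \<partial>M)
      \<le> ennreal (C' ^ n * fact n powr q * measure lborel S powr (real n * (1 - q)))" .
  next
    fix a r x n assume r: "0 < r" "rho_ball H a r \<subseteq> T" and n: "1 \<le> (n::nat)"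
    \<comment> \<open>A \<open>\<rho>\<close>-ball is in general not an interval. Its enclosing box
      may leave \<open>T\<close>, so it is intersected with \<open>T\<close> before the interval
      bound is applied.\<close>
    define S where "S = T \<inter> cbox (\<chi> j. a $ j - r powr (1 / H $ j)) (\<chi> j. a $ j + r powr (1 / H $ j))"
    have S: "is_interval S" "S \<subseteq> T" "S \<in> sets borel"
      using T unfolding S_def by (auto intro: is_interval_Int is_interval_cbox)
    have "measure lborel S \<le> measure lborel (cbox (\<chi> j. a $ j - r powr (1 / H $ j)) (\<chi> j. a $ j + r powr (1 / H $ j)))"
      using S by (intro measure_mono_fmeasurable) (auto simp: S_def intro: fmeasurable_cbox)
    also have "\<dots> = 2 ^ N * r powr hdim H"
      using emeasure_rho_cbox[OF r(1), of a H] by (simp add: measure_def N_def)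
    finally have vol: "measure lborel S \<le> 2 ^ N * r powr hdim H" .
    have "(\<integral>\<^sup>+\<omega>. emeasure (L \<omega> x) (rho_ball H a r) ^ n \<partial>M) \<le> (\<integral>\<^sup>+\<omega>. emeasure (L \<omega> x) S ^ n \<partial>M)"
      by (rule mono[OF _ S(3)]) (use rho_ball_subset_cbox[OF H r(1), of a] r(2) in \<open>auto simp: S_def\<close>)
    also have "\<dots> \<le> ennreal (C ^ n * fact n powr q * measure lborel S powr (real n * (1 - q)))"
      by (rule int[OF S(1,2) n])
    also have "\<dots> \<le> ennreal (C ^ n * fact n powr q * (2 ^ N * r powr hdim H) powr (real n * (1 - q)))"
      using vol C q by (intro ennreal_leI mult_left_mono powr_mono2) auto
    also have "C ^ n * fact n powr q * (2 ^ N * r powr hdim H) powr (real n * (1 - q))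
      = C' ^ n * fact n powr q * r powr (real n * (hdim H - real CARD('d)))"
    proof -
      have 1: "hdim H * (real n * (1 - q)) = real n * (hdim H - real CARD('d))"
        using Q by (simp add: q_def field_simps)
      have 2: "C' ^ n = C ^ n * (2 ^ N) powr (real n * (1 - q))"
        by (simp add: C'_def power_mult_distrib powr_power mult.commute)
      have 3: "(2 ^ N * r powr hdim H) powr p = (2 ^ N) powr p * r powr (hdim H * p)" for p
        using r(1) by (simp add: powr_mult powr_powr)
      show ?thesis unfolding 3 1 2 by (simp only: mult_ac)
    qed
    finally show "(\<integral>\<^sup>+\<omega>. emeasure (L \<omega> x) (rho_ball H a r) ^ n \<partial>M)
      \<le> ennreal (C' ^ n * fact n powr q * r powr (real n * (hdim H - real CARD('d))))" .
  qed
qed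

end
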